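(* Let $A=(A,\cdot)$ be an algebra over a field $k$, let $\alpha,\beta\in k^*=k\setminus\{0\}$ and let $0\neq z\in Z(A)$. Then the linear map $$R=R_{\alpha,\beta,z}:A\otimes A\to A\otimes A,\qquad R(a\otimes b):=\alpha\, b\otimes a+\beta\, z\otimes (a\cdot b)$$ is a solution of the quantum Yang-Baxter equation if and only if $(A,\cdot)$ is a Leibniz algebra. In particular, if $A$ is a Jacobi-Jordan algebra, then $R_{\alpha,\beta,z}$ is a solution of the quantum Yang-Baxter equation if and only if $\mathrm{char}(k)=2$ or $A$ is an at most $3$-step nilpotent algebra.
   Context: $k$ is an arbitrary field and $\otimes=\otimes_k$. An algebra is a pair $(A,\cdot)$ consisting of a $k$-vector space $A$ and a bilinear map $\cdot:A\times A\to A$ (no further axioms). $Z(A):=\{z\in A \mid z\cdot A=A\cdot z=0\}$ is the Leibniz center of $A$. A Leibniz algebra is an algebra with $(a\cdot b)\cdot c=a\cdot(b\cdot c)+(a\cdot c)\cdot b$ for all $a,b,c\in A$. A Jacobi-Jordan algebra is an algebra with $a\cdot b=b\cdot a$ and $a\cdot(b\cdot c)+b\cdot(c\cdot a)+c\cdot(a\cdot b)=0$ for all $a,b,c\in A$. For $R\in \mathrm{End}_k(A\otimes A)$ put $R^{12}:=R\otimes \mathrm{Id}_A$ and $R^{23}:=\mathrm{Id}_A\otimes R$ in $\mathrm{End}_k(A\otimes A\otimes A)$; $R$ is a solution of the quantum Yang-Baxter equation if $R^{12}R^{23}R^{12}=R^{23}R^{12}R^{23}$. For subspaces $X,Y$ of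 $A$, $X\cdot Y$ is the subspace spanned by all $x\cdot y$, $x\in X$, $y\in Y$. The lower central series is $A^1:=A$, $A^{n+1}:=\sum_{i=1}^n A^i\cdot A^{n+1-i}$; $A$ is nilpotent of step $m>1$ if $A^m=0$ and $A^i\ne 0$ for all $i<m$. Thus "at most $3$-step nilpotent" means $A^3=0$. *)

theory Defs
  imports
    "HOL-Algebra.Multiplicative_Group"
    "Jordan_Normal_Form.Missing_VectorSpace"
begin

section \<open>Quotient modules and tensor products\<close>

text \<open>In the module records below, the fields \<open>mult\<close> and \<open>one\<close> (inherited from rings) carry no
  meaning.\<close>

definition quotient_module ::
    "('k, 'm) ring_scheme \<Rightarrow> ('k, 'v, 'n) module_scheme \<Rightarrow> 'v set \<Rightarrow> ('k, 'v set) module" where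
  "quotient_module K M N =
    \<lparr>carrier = a_rcosets\<^bsub>M\<^esub> N, mult = undefined, one = undefined,
     zero = N, add = set_add M,
     smult = (\<lambda>c X. N <+>\<^bsub>M\<^esub> (\<lambda>x. c \<odot>\<^bsub>M\<^esub> x) ` X)\<rparr>"

definition free_module :: "('k, 'm) ring_scheme \<Rightarrow> 'x set \<Rightarrow> ('k, 'x \<Rightarrow> 'k) module" where
  "free_module K X =
    \<lparr>carrier = {f. (\<forall>x. f x \<in> carrier K) \<and> (\<forall>x. x \<notin> X \<longrightarrow> f x = \<zero>\<^bsub>K\<^esub>) \<and> finite {x. f x \<noteq> \<zero>\<^bsub>K\<^esub>}},
     mult = undefined, one = undefined,
     zero = (\<lambda>x. \<zero>\<^bsub>K\<^esub>), add = (\<lambda>f g x. f x \<oplus>\<^bsub>K\<^esub> g x),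
     smult = (\<lambda>c f x. c \<otimes>\<^bsub>K\<^esub> f x)\<rparr>"

definition free_gen :: "('k, 'm) ring_scheme \<Rightarrow> 'x \<Rightarrow> 'x \<Rightarrow> 'k" where
  "free_gen K x = (\<lambda>y. if y = x then \<one>\<^bsub>K\<^esub> else \<zero>\<^bsub>K\<^esub>)"

text \<open>\<open>V \<otimes> W\<close> is the free module on \<open>V \<times> W\<close> modulo the span of the bilinearity relations.\<close>

definition tensor_relations ::
    "('k, 'm) ring_scheme \<Rightarrow> ('k, 'v, 'n) module_scheme \<Rightarrow> ('k, 'w, 'p) module_scheme
      \<Rightarrow> ('v \<times> 'w \<Rightarrow> 'k) set" where
  "tensor_relations K V W =
    (let F = free_module K (carrier V \<times> carrier W); d = (\<lambda>v w. free_gen K (v, w)) in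
      {d (v \<oplus>\<^bsub>V\<^esub> v') w \<ominus>\<^bsub>F\<^esub> (d v w \<oplus>\<^bsub>F\<^esub> d v' w) | v v' w.
          v \<in> carrier V \<and> v' \<in> carrier V \<and> w \<in> carrier W}
    \<union> {d v (w \<oplus>\<^bsub>W\<^esub> w') \<ominus>\<^bsub>F\<^esub> (d v w \<oplus>\<^bsub>F\<^esub> d v w') | v w w'.
          v \<in> carrier V \<and> w \<in> carrier W \<and> w' \<in> carrier W}
    \<union> {d (c \<odot>\<^bsub>V\<^esub> v) w \<ominus>\<^bsub>F\<^esub> c \<odot>\<^bsub>F\<^esub> d v w | c v w.
          c \<in> carrier K \<and> v \<in> carrier V \<and> w \<in> carrier W}
    \<union> {d v (c \<odot>\<^bsub>W\<^esub> w) \<ominus>\<^bsub>F\<^esub> c \<odot>\<^bsub>F\<^esub> d v w | c v w.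
          c \<in> carrier K \<and> v \<in> carrier V \<and> w \<in> carrier W})"

definition tensor_null ::
    "('k, 'm) ring_scheme \<Rightarrow> ('k, 'v, 'n) module_scheme \<Rightarrow> ('k, 'w, 'p) module_scheme
      \<Rightarrow> ('v \<times> 'w \<Rightarrow> 'k) set" where
  "tensor_null K V W =
    LinearCombinations.module.span K (free_module K (carrier V \<times> carrier W)) (tensor_relations K V W)"

definition tensor_module ::
    "('k, 'm) ring_scheme \<Rightarrow> ('k, 'v, 'n) module_scheme \<Rightarrow> ('k, 'w, 'p) module_scheme
      \<Rightarrow> ('k, ('v \<times> 'w \<Rightarrow> 'k) set) module" where
  "tensor_module K V W =
    quotient_module K (free_module K (carrier V \<times> carrier W)) (tensor_null K V W)"

definition pure_tensor ::
    "('k, 'm) ring_scheme \<Rightarrow> ('k, 'v, 'n) module_scheme \<Rightarrow> ('k, 'w, 'p) module_scheme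
      \<Rightarrow> 'v \<Rightarrow> 'w \<Rightarrow> ('v \<times> 'w \<Rightarrow> 'k) set" where
  "pure_tensor K V W v w =
    tensor_null K V W +>\<^bsub>free_module K (carrier V \<times> carrier W)\<^esub> free_gen K (v, w)"

text \<open>The linear map on \<open>V \<otimes> W\<close> with prescribed values \<open>h v w\<close> on the pure tensors
  \<open>v \<otimes> w\<close>, where \<open>h\<close> is bilinear. It is made extensional so that it is unique as a HOL
  function; existence and uniqueness are \<open>tensor_lift_universal\<close> and \<open>tensor_hom_eqI\<close>
  below.\<close>

definition tensor_lift ::
    "('k, 'm) ring_scheme \<Rightarrow> ('k, 'v, 'n) module_scheme \<Rightarrow> ('k, 'w, 'p) module_scheme
      \<Rightarrow> ('k, 'u, 'q) module_scheme \<Rightarrow> ('v \<Rightarrow> 'w \<Rightarrow> 'u) \<Rightarrow> ('v \<times> 'w \<Rightarrow> 'k) set \<Rightarrow> 'u" where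
  "tensor_lift K V W U h =
    (THE f. f \<in> module_hom K (tensor_module K V W) U
      \<and> f \<in> extensional (carrier (tensor_module K V W))
      \<and> (\<forall>v\<in>carrier V. \<forall>w\<in>carrier W. f (pure_tensor K V W v w) = h v w))"

definition tensor_map ::
    "('k, 'm) ring_scheme \<Rightarrow> ('k, 'v, 'n) module_scheme \<Rightarrow> ('k, 'w, 'p) module_scheme
      \<Rightarrow> ('k, 'v2, 'n2) module_scheme \<Rightarrow> ('k, 'w2, 'p2) module_scheme
      \<Rightarrow> ('v \<Rightarrow> 'v2) \<Rightarrow> ('w \<Rightarrow> 'w2) \<Rightarrow> ('v \<times> 'w \<Rightarrow> 'k) set \<Rightarrow> ('v2 \<times> 'w2 \<Rightarrow> 'k) set" where
  "tensor_map K V W V' W' f g =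
    tensor_lift K V W (tensor_module K V' W') (\<lambda>v w. pure_tensor K V' W' (f v) (g w))"

text \<open>The canonical isomorphisms \<open>(U \<otimes> V) \<otimes> W \<rightarrow> U \<otimes> (V \<otimes> W)\<close> and back.\<close>

definition tensor_assoc ::
    "('k, 'm) ring_scheme \<Rightarrow> ('k, 'u, 'n) module_scheme \<Rightarrow> ('k, 'v, 'p) module_scheme
      \<Rightarrow> ('k, 'w, 'q) module_scheme
      \<Rightarrow> (('u \<times> 'v \<Rightarrow> 'k) set \<times> 'w \<Rightarrow> 'k) set \<Rightarrow> ('u \<times> ('v \<times> 'w \<Rightarrow> 'k) set \<Rightarrow> 'k) set" where
  "tensor_assoc K U V W =
    (let VW = tensor_module K V W; T = tensor_module K U VW in
      tensor_lift K (tensor_module K U V) W T (\<lambda>t w.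
        tensor_lift K U V T (\<lambda>u v. pure_tensor K U VW u (pure_tensor K V W v w)) t))"

definition tensor_assoc_inv ::
    "('k, 'm) ring_scheme \<Rightarrow> ('k, 'u, 'n) module_scheme \<Rightarrow> ('k, 'v, 'p) module_scheme
      \<Rightarrow> ('k, 'w, 'q) module_scheme
      \<Rightarrow> ('u \<times> ('v \<times> 'w \<Rightarrow> 'k) set \<Rightarrow> 'k) set \<Rightarrow> (('u \<times> 'v \<Rightarrow> 'k) set \<times> 'w \<Rightarrow> 'k) set" where
  "tensor_assoc_inv K U V W =
    (let UV = tensor_module K U V; T = tensor_module K UV W in
      tensor_lift K U (tensor_module K V W) T (\<lambda>u t.
        tensor_lift K V W T (\<lambda>v w. pure_tensor K UV W (pure_tensor K U V u v) w) t))"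


section \<open>The quantum Yang-Baxter equation\<close>

text \<open>The threefold tensor power is taken to be \<open>(A \<otimes> A) \<otimes> A\<close>; \<open>Id \<otimes> R\<close> acts on it through
  the identification with \<open>A \<otimes> (A \<otimes> A)\<close>.\<close>

definition R12 ::
    "('k, 'm) ring_scheme \<Rightarrow> ('k, 'a, 'n) module_scheme
      \<Rightarrow> (('a \<times> 'a \<Rightarrow> 'k) set \<Rightarrow> ('a \<times> 'a \<Rightarrow> 'k) set)
      \<Rightarrow> (('a \<times> 'a \<Rightarrow> 'k) set \<times> 'a \<Rightarrow> 'k) set \<Rightarrow> (('a \<times> 'a \<Rightarrow> 'k) set \<times> 'a \<Rightarrow> 'k) set" where
  "R12 K A R =
    (let AA = tensor_module K A A in tensor_map K AA A AA A R (\<lambda>a. a))"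

definition R23 ::
    "('k, 'm) ring_scheme \<Rightarrow> ('k, 'a, 'n) module_scheme
      \<Rightarrow> (('a \<times> 'a \<Rightarrow> 'k) set \<Rightarrow> ('a \<times> 'a \<Rightarrow> 'k) set)
      \<Rightarrow> (('a \<times> 'a \<Rightarrow> 'k) set \<times> 'a \<Rightarrow> 'k) set \<Rightarrow> (('a \<times> 'a \<Rightarrow> 'k) set \<times> 'a \<Rightarrow> 'k) set" where
  "R23 K A R =
    (let AA = tensor_module K A A in
      tensor_assoc_inv K A A A \<circ> tensor_map K A AA A AA (\<lambda>a. a) R \<circ> tensor_assoc K A A A)"

definition qybe_solution ::
    "('k, 'm) ring_scheme \<Rightarrow> ('k, 'a, 'n) module_scheme
      \<Rightarrow> (('a \<times> 'a \<Rightarrow> 'k) set \<Rightarrow> ('a \<times> 'a \<Rightarrow> 'k) set) \<Rightarrow> bool" where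
  "qybe_solution K A R \<longleftrightarrow>
    R \<in> module_hom K (tensor_module K A A) (tensor_module K A A) \<and>
    (\<forall>t\<in>carrier (tensor_module K (tensor_module K A A) A).
      R12 K A R (R23 K A R (R12 K A R t)) = R23 K A R (R12 K A R (R23 K A R t)))"


section \<open>Algebras\<close>

text \<open>The product of the algebra is the field \<open>mult\<close> of the record \<open>A\<close>; nothing is assumed
  about its field \<open>one\<close>.\<close>

locale nonassoc_algebra = vectorspace K A
  for K :: "('k, 'm) ring_scheme" and A :: "('k, 'a, 'n) module_scheme" +
  assumes mult_closed:
      "\<lbrakk>a \<in> carrier A; b \<in> carrier A\<rbrakk> \<Longrightarrow> a \<otimes>\<^bsub>A\<^esub> b \<in> carrier A"
    and mult_add_left:
      "\<lbrakk>a \<in> carrier A; b \<in> carrier A; c \<in> carrier A\<rbrakk>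
        \<Longrightarrow> (a \<oplus>\<^bsub>A\<^esub> b) \<otimes>\<^bsub>A\<^esub> c = a \<otimes>\<^bsub>A\<^esub> c \<oplus>\<^bsub>A\<^esub> b \<otimes>\<^bsub>A\<^esub> c"
    and mult_add_right:
      "\<lbrakk>a \<in> carrier A; b \<in> carrier A; c \<in> carrier A\<rbrakk>
        \<Longrightarrow> a \<otimes>\<^bsub>A\<^esub> (b \<oplus>\<^bsub>A\<^esub> c) = a \<otimes>\<^bsub>A\<^esub> b \<oplus>\<^bsub>A\<^esub> a \<otimes>\<^bsub>A\<^esub> c"
    and mult_smult_left:
      "\<lbrakk>r \<in> carrier K; a \<in> carrier A; b \<in> carrier A\<rbrakk>
        \<Longrightarrow> (r \<odot>\<^bsub>A\<^esub> a) \<otimes>\<^bsub>A\<^esub> b = r \<odot>\<^bsub>A\<^esub> (a \<otimes>\<^bsub>A\<^esub> b)"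
    and mult_smult_right:
      "\<lbrakk>r \<in> carrier K; a \<in> carrier A; b \<in> carrier A\<rbrakk>
        \<Longrightarrow> a \<otimes>\<^bsub>A\<^esub> (r \<odot>\<^bsub>A\<^esub> b) = r \<odot>\<^bsub>A\<^esub> (a \<otimes>\<^bsub>A\<^esub> b)"

locale leibniz_algebra = nonassoc_algebra +
  assumes leibniz:
      "\<lbrakk>a \<in> carrier A; b \<in> carrier A; c \<in> carrier A\<rbrakk>
        \<Longrightarrow> (a \<otimes>\<^bsub>A\<^esub> b) \<otimes>\<^bsub>A\<^esub> c = a \<otimes>\<^bsub>A\<^esub> (b \<otimes>\<^bsub>A\<^esub> c) \<oplus>\<^bsub>A\<^esub> (a \<otimes>\<^bsub>A\<^esub> c) \<otimes>\<^bsub>A\<^esub> b"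

locale jacobi_jordan_algebra = nonassoc_algebra +
  assumes mult_commute:
      "\<lbrakk>a \<in> carrier A; b \<in> carrier A\<rbrakk> \<Longrightarrow> a \<otimes>\<^bsub>A\<^esub> b = b \<otimes>\<^bsub>A\<^esub> a"
    and jacobi:
      "\<lbrakk>a \<in> carrier A; b \<in> carrier A; c \<in> carrier A\<rbrakk>
        \<Longrightarrow> a \<otimes>\<^bsub>A\<^esub> (b \<otimes>\<^bsub>A\<^esub> c) \<oplus>\<^bsub>A\<^esub> b \<otimes>\<^bsub>A\<^esub> (c \<otimes>\<^bsub>A\<^esub> a) \<oplus>\<^bsub>A\<^esub> c \<otimes>\<^bsub>A\<^esub> (a \<otimes>\<^bsub>A\<^esub> b) = \<zero>\<^bsub>A\<^esub>"

definition leibniz_center :: "('k, 'a, 'n) module_scheme \<Rightarrow> 'a set" where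
  "leibniz_center A =
    {z \<in> carrier A. \<forall>a\<in>carrier A. z \<otimes>\<^bsub>A\<^esub> a = \<zero>\<^bsub>A\<^esub> \<and> a \<otimes>\<^bsub>A\<^esub> z = \<zero>\<^bsub>A\<^esub>}"

definition R_map ::
    "('k, 'm) ring_scheme \<Rightarrow> ('k, 'a, 'n) module_scheme \<Rightarrow> 'k \<Rightarrow> 'k \<Rightarrow> 'a
      \<Rightarrow> ('a \<times> 'a \<Rightarrow> 'k) set \<Rightarrow> ('a \<times> 'a \<Rightarrow> 'k) set" where
  "R_map K A \<alpha> \<beta> z =
    (let AA = tensor_module K A A in
      tensor_lift K A A AA (\<lambda>a b.
        \<alpha> \<odot>\<^bsub>AA\<^esub> pure_tensor K A A b a \<oplus>\<^bsub>AA\<^esub> \<beta> \<odot>\<^bsub>AA\<^esub> pure_tensor K A A z (a \<otimes>\<^bsub>A\<^esub> b)))"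

definition subspace_prod ::
    "('k, 'm) ring_scheme \<Rightarrow> ('k, 'a, 'n) module_scheme \<Rightarrow> 'a set \<Rightarrow> 'a set \<Rightarrow> 'a set" where
  "subspace_prod K A X Y =
    LinearCombinations.module.span K A {x \<otimes>\<^bsub>A\<^esub> y | x y. x \<in> X \<and> y \<in> Y}"

text \<open>The lower central series is indexed from 1; the value at 0 is a dummy. The sum of a family
  of subspaces is the span of their union.\<close>

fun lower_central ::
    "('k, 'm) ring_scheme \<Rightarrow> ('k, 'a, 'n) module_scheme \<Rightarrow> nat \<Rightarrow> 'a set" where
  "lower_central K A n =
    (if n \<le> 1 then carrier A
     else LinearCombinations.module.span K A
       (\<Union>i\<in>{1..n - 1}. subspace_prod K A (lower_central K A i) (lower_central K A (n - i))))"

declare lower_central.simps [simp del]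

text \<open>For \<open>A \<noteq> 0\<close> and \<open>m \<ge> 2\<close>: \<open>A\<close> is nilpotent of some step at most \<open>m\<close>.\<close>

definition at_most_step_nilpotent ::
    "('k, 'm) ring_scheme \<Rightarrow> ('k, 'a, 'n) module_scheme \<Rightarrow> nat \<Rightarrow> bool" where
  "at_most_step_nilpotent K A m \<longleftrightarrow> lower_central K A m = {\<zero>\<^bsub>A\<^esub>}"

text \<open>The additive order of \<open>1\<close>, which is \<open>0\<close> if that order is infinite.\<close>

definition ring_char :: "('k, 'm) ring_scheme \<Rightarrow> nat" where
  "ring_char K = group.ord (add_monoid K) \<one>\<^bsub>K\<^esub>"


section \<open>The maps above on pure tensors\<close>

text \<open>The universal property of the tensor product, and the resulting formulas for the maps defined
  through \<open>tensor_lift\<close>.\<close>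

lemma (in abelian_group) minus_zero_iff:
  "a \<in> carrier G \<Longrightarrow> b \<in> carrier G \<Longrightarrow> a \<ominus> b = \<zero> \<longleftrightarrow> a = b"
  using minus_equality[of a "\<ominus> b"] by (auto simp: a_minus_def r_neg)

lemma quotient_module_sel: "carrier (quotient_module K M N) = a_rcosets\<^bsub>M\<^esub> N"
  "zero (quotient_module K M N) = N"
  "add (quotient_module K M N) = set_add M"
  "smult (quotient_module K M N) = (\<lambda>c X. N <+>\<^bsub>M\<^esub> (\<lambda>x. c \<odot>\<^bsub>M\<^esub> x) ` X)"
  by (auto simp: quotient_module_def)

lemma free_module_sel: "carrier (free_module K X) = {f. (\<forall>x. f x \<in> carrier K) \<and> (\<forall>x. x \<notin> X \<longrightarrow> f x = \<zero>\<^bsub>K\<^esub>) \<and> finite {x. f x \<noteq> \<zero>\<^bsub>K\<^esub>}}"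
  "zero (free_module K X) = (\<lambda>x. \<zero>\<^bsub>K\<^esub>)"
  "add (free_module K X) = (\<lambda>f g x. f x \<oplus>\<^bsub>K\<^esub> g x)"
  "smult (free_module K X) = (\<lambda>c f x. c \<otimes>\<^bsub>K\<^esub> f x)"
  by (auto simp: free_module_def)

lemma free_module_is_module:
  assumes "cring K" shows "module K (free_module K X)"
proof -
  interpret cring K by fact
  have fin: "finite {x. (f x \<oplus>\<^bsub>K\<^esub> g x) \<noteq> \<zero>\<^bsub>K\<^esub>}"
    if "finite {x. f x \<noteq> \<zero>\<^bsub>K\<^esub>}" "finite {x. g x \<noteq> \<zero>\<^bsub>K\<^esub>}" for f g
    by (rule finite_subset[OF _ finite_UnI[OF that]]) auto
  have fin2: "finite {x. (c \<otimes>\<^bsub>K\<^esub> g x) \<noteq> \<zero>\<^bsub>K\<^esub>}"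
    if "finite {x. g x \<noteq> \<zero>\<^bsub>K\<^esub>}" "c \<in> carrier K" for c g
    by (rule finite_subset[OF _ that(1)]) (use that in auto)
  have fin3: "finite {x. (\<ominus>\<^bsub>K\<^esub> g x) \<noteq> \<zero>\<^bsub>K\<^esub>}"
    if "finite {x. g x \<noteq> \<zero>\<^bsub>K\<^esub>}" for g
    by (rule finite_subset[OF _ that(1)]) auto
  show ?thesis
  proof (rule module_criteria, goal_cases)
    case 4
    show ?case
    proof (intro ballI)
      fix v assume "v \<in> carrier (free_module K X)"
      then show "\<exists>neg_v\<in>carrier (free_module K X). v \<oplus>\<^bsub>free_module K X\<^esub> neg_v = \<zero>\<^bsub>free_module K X\<^esub>"
        by (intro bexI[of _ "\<lambda>x. \<ominus>\<^bsub>K\<^esub> v x"]) (auto simp: free_module_sel r_neg fin3)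
    qed
  qed (auto simp: free_module_sel fun_eq_iff fin fin2 a_ac m_ac l_distr r_distr is_cring)
qed

context module begin

lemma submodule_abelian:
  assumes "LinearCombinations.submodule R N M" shows "abelian_subgroup N M"
proof -
  have "additive_subgroup N M"
  proof (rule additive_subgroup.intro, rule add.subgroupI)
    show "N \<subseteq> carrier M" "N \<noteq> {}" using assms by (auto simp: LinearCombinations.submodule_def)
  next
    fix a assume "a \<in> N"
    moreover have "a \<in> carrier M" using \<open>a \<in> N\<close> assms by (auto simp: LinearCombinations.submodule_def)
    then have "\<ominus>\<^bsub>M\<^esub> a = (\<ominus>\<^bsub>R\<^esub> \<one>\<^bsub>R\<^esub>) \<odot>\<^bsub>M\<^esub> a" by (simp add: smult_l_minus)
    ultimately show "\<ominus>\<^bsub>M\<^esub> a \<in> N" using assms by (simp add: LinearCombinations.submodule_def)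
  next
    fix a b assume "a \<in> N" "b \<in> N"
    then show "a \<oplus>\<^bsub>M\<^esub> b \<in> N" using assms by (auto simp: LinearCombinations.submodule_def)
  qed
  then show ?thesis using abelian_group_axioms by (rule abelian_subgroupI3)
qed

lemma quotient_module_smult:
  assumes "LinearCombinations.submodule R N M" "c \<in> carrier R" "x \<in> carrier M"
  shows "N <+>\<^bsub>M\<^esub> (\<lambda>x. c \<odot>\<^bsub>M\<^esub> x) ` (N +>\<^bsub>M\<^esub> x) = N +>\<^bsub>M\<^esub> c \<odot>\<^bsub>M\<^esub> x"
proof -
  note s = assms(1)[unfolded LinearCombinations.submodule_def]
  have sub: "\<And>n. n \<in> N \<Longrightarrow> n \<in> carrier M" using s by auto
  show ?thesis
  proof (intro equalityI subsetI)
    fix y assume "y \<in> N <+>\<^bsub>M\<^esub> (\<lambda>x. c \<odot>\<^bsub>M\<^esub> x) ` (N +>\<^bsub>M\<^esub> x)"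
    then obtain n n' where n: "n \<in> N" "n' \<in> N" "y = n \<oplus>\<^bsub>M\<^esub> (c \<odot>\<^bsub>M\<^esub> (n' \<oplus>\<^bsub>M\<^esub> x))"
      by (auto simp: set_add_def' a_r_coset_def')
    have "y = (n \<oplus>\<^bsub>M\<^esub> c \<odot>\<^bsub>M\<^esub> n') \<oplus>\<^bsub>M\<^esub> c \<odot>\<^bsub>M\<^esub> x"
      using n assms sub by (simp add: smult_r_distr M.a_assoc)
    moreover have "n \<oplus>\<^bsub>M\<^esub> c \<odot>\<^bsub>M\<^esub> n' \<in> N" using s n assms by auto
    ultimately show "y \<in> N +>\<^bsub>M\<^esub> c \<odot>\<^bsub>M\<^esub> x" by (auto simp: a_r_coset_def')
  next
    fix y assume "y \<in> N +>\<^bsub>M\<^esub> c \<odot>\<^bsub>M\<^esub> x"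
    then obtain n where n: "n \<in> N" "y = n \<oplus>\<^bsub>M\<^esub> c \<odot>\<^bsub>M\<^esub> x" by (auto simp: a_r_coset_def')
    have "x \<in> N +>\<^bsub>M\<^esub> x" using s assms unfolding a_r_coset_def'
      by (intro UN_I[of "\<zero>\<^bsub>M\<^esub>"]) auto
    then show "y \<in> N <+>\<^bsub>M\<^esub> (\<lambda>x. c \<odot>\<^bsub>M\<^esub> x) ` (N +>\<^bsub>M\<^esub> x)"
      using n by (auto simp: set_add_def')
  qed
qed

lemma quotient_module_hom:
  assumes N: "LinearCombinations.submodule R N M"
  shows "module R (quotient_module R M N)" 
    and "(\<lambda>x. N +>\<^bsub>M\<^esub> x) \<in> module_hom R M (quotient_module R M N)"
    and "carrier (quotient_module R M N) = (\<lambda>x. N +>\<^bsub>M\<^esub> x) ` carrier M"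
proof -
  interpret N: abelian_subgroup N M by (rule submodule_abelian[OF N])
  show c: "carrier (quotient_module R M N) = (\<lambda>x. N +>\<^bsub>M\<^esub> x) ` carrier M"
    by (auto simp: quotient_module_sel A_RCOSETS_def')
  have a: "(N +>\<^bsub>M\<^esub> x) \<oplus>\<^bsub>quotient_module R M N\<^esub> (N +>\<^bsub>M\<^esub> y) = N +>\<^bsub>M\<^esub> (x \<oplus>\<^bsub>M\<^esub> y)"
    if "x \<in> carrier M" "y \<in> carrier M" for x y
    using that by (simp add: quotient_module_sel N.a_rcos_sum)
  have s: "r \<odot>\<^bsub>quotient_module R M N\<^esub> (N +>\<^bsub>M\<^esub> y) = N +>\<^bsub>M\<^esub> (r \<odot>\<^bsub>M\<^esub> y)"
    if "r \<in> carrier R" "y \<in> carrier M" for r y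
    using that by (simp add: quotient_module_sel quotient_module_smult[OF N])
  have z: "\<zero>\<^bsub>quotient_module R M N\<^esub> = N +>\<^bsub>M\<^esub> \<zero>\<^bsub>M\<^esub>"
    using N.a_subset M.a_coset_add_zero by (simp add: quotient_module_sel)
  show "(\<lambda>x. N +>\<^bsub>M\<^esub> x) \<in> module_hom R M (quotient_module R M N)"
    by (auto simp: module_hom_def a s c)
  show "module R (quotient_module R M N)"
  proof (rule module_criteria, goal_cases)
    case 4
    show ?case unfolding c
    proof (intro ballI, elim imageE)
      fix v x assume *: "v = N +>\<^bsub>M\<^esub> x" "x \<in> carrier M"
      then show "\<exists>neg_v\<in>(+>\<^bsub>M\<^esub>) N ` carrier M. v \<oplus>\<^bsub>quotient_module R M N\<^esub> neg_v = \<zero>\<^bsub>quotient_module R M N\<^esub>"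
        by (intro bexI[of _ "N +>\<^bsub>M\<^esub> (\<ominus>\<^bsub>M\<^esub> x)"]) (auto simp: a z M.r_neg)
    qed
  qed (auto simp: c a s z M.a_ac smult_l_distr smult_r_distr smult_assoc1 R.is_cring)
qed

lemma hom_minus:
  assumes "module R U" "f \<in> module_hom R M U" "x \<in> carrier M" "y \<in> carrier M"
  shows "f (x \<ominus>\<^bsub>M\<^esub> y) = f x \<ominus>\<^bsub>U\<^esub> f y" "f \<zero>\<^bsub>M\<^esub> = \<zero>\<^bsub>U\<^esub>"
proof -
  interpret h: mod_hom R M U f using assms module_axioms by (auto simp: mod_hom_def mod_hom_axioms_def)
  show "f \<zero>\<^bsub>M\<^esub> = \<zero>\<^bsub>U\<^esub>" by simp
  have "f ((\<ominus>\<^bsub>R\<^esub> \<one>\<^bsub>R\<^esub>) \<odot>\<^bsub>M\<^esub> y) = (\<ominus>\<^bsub>R\<^esub> \<one>\<^bsub>R\<^esub>) \<odot>\<^bsub>U\<^esub> f y" using assms by (intro h.f_smult) auto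
  then have "f (\<ominus>\<^bsub>M\<^esub> y) = \<ominus>\<^bsub>U\<^esub> f y" using assms by (simp add: smult_l_minus h.N.smult_l_minus)
  then show "f (x \<ominus>\<^bsub>M\<^esub> y) = f x \<ominus>\<^bsub>U\<^esub> f y"
    using assms by (simp add: a_minus_def)
qed

lemma quotient_module_lift:
  assumes N: "LinearCombinations.submodule R N M" and U: "module R U" and f: "f \<in> module_hom R M U"
    and fN: "\<And>n. n \<in> N \<Longrightarrow> f n = \<zero>\<^bsub>U\<^esub>"
  shows "\<exists>g \<in> module_hom R (quotient_module R M N) U. \<forall>x\<in>carrier M. g (N +>\<^bsub>M\<^esub> x) = f x"
proof -
  interpret U: module R U by fact
  interpret N: abelian_subgroup N M by (rule submodule_abelian[OF N])
  interpret h: mod_hom R M U f using assms module_axioms by (auto simp: mod_hom_def mod_hom_axioms_def)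
  define g where "g X = f (SOME x. x \<in> X)" for X
  have g: "g (N +>\<^bsub>M\<^esub> x) = f x" if x: "x \<in> carrier M" for x
  proof -
    have "x \<in> N +>\<^bsub>M\<^esub> x" using x by (simp add: N.a_rcos_self)
    then have "(SOME y. y \<in> N +>\<^bsub>M\<^esub> x) \<in> N +>\<^bsub>M\<^esub> x" by (rule someI)
    then obtain n where "n \<in> N" "(SOME y. y \<in> N +>\<^bsub>M\<^esub> x) = n \<oplus>\<^bsub>M\<^esub> x" by (auto simp: a_r_coset_def')
    then show ?thesis using x fN[of n] N.a_Hcarr[of n] by (simp add: g_def)
  qed
  note q = quotient_module_hom[OF N]
  have "g \<in> module_hom R (quotient_module R M N) U"
    unfolding module_hom_def q(3)
    using module_hom_add[OF q(2), symmetric] module_hom_smult[OF q(2), symmetric]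
    by (auto simp: g)
  then show ?thesis using g by blast
qed

end

lemma free_module_lift:
  assumes U: "module K U" and h: "\<And>x. x \<in> X \<Longrightarrow> h x \<in> carrier U"
  shows "\<exists>F \<in> module_hom K (free_module K X) U. \<forall>x\<in>X. F (free_gen K x) = h x"
proof -
  interpret U: module K U by fact
  define F where "F f = (\<Oplus>\<^bsub>U\<^esub> x\<in>{x. f x \<noteq> \<zero>\<^bsub>K\<^esub>}. f x \<odot>\<^bsub>U\<^esub> h x)" for f
  have ext: "F f = (\<Oplus>\<^bsub>U\<^esub> x\<in>S. f x \<odot>\<^bsub>U\<^esub> h x)"
    if "f \<in> carrier (free_module K X)" "finite S" "{x. f x \<noteq> \<zero>\<^bsub>K\<^esub>} \<subseteq> S" "S \<subseteq> X" for f S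
    unfolding F_def using that h
    by (intro U.M.add.finprod_mono_neutral_cong_left) (auto simp: free_module_sel)
  have supp: "finite {x. f x \<noteq> \<zero>\<^bsub>K\<^esub>}" "{x. f x \<noteq> \<zero>\<^bsub>K\<^esub>} \<subseteq> X" if "f \<in> carrier (free_module K X)" for f
    using that by (auto simp: free_module_sel)
  interpret FM: module K "free_module K X" by (rule free_module_is_module) (rule U.R.is_cring)
  have "F \<in> module_hom K (free_module K X) U"
    unfolding module_hom_def
  proof (safe)
    fix f assume "f \<in> carrier (free_module K X)"
    then show "F f \<in> carrier U" unfolding F_def using h supp[of f]
      by (intro U.M.add.finprod_closed) (auto simp: free_module_sel)
  next
    fix f g assume f: "f \<in> carrier (free_module K X)" and g: "g \<in> carrier (free_module K X)"
    let ?S = "{x. f x \<noteq> \<zero>\<^bsub>K\<^esub>} \<union> {x. g x \<noteq> \<zero>\<^bsub>K\<^esub>}"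
    have c: "f \<oplus>\<^bsub>free_module K X\<^esub> g \<in> carrier (free_module K X)" using f g by simp
    have S: "finite ?S" "?S \<subseteq> X" using supp f g by auto
    have "F (f \<oplus>\<^bsub>free_module K X\<^esub> g) = (\<Oplus>\<^bsub>U\<^esub> x\<in>?S. (f x \<oplus>\<^bsub>K\<^esub> g x) \<odot>\<^bsub>U\<^esub> h x)"
      by (subst ext[OF c S(1) _ S(2)]) (auto simp: free_module_sel)
    also have "\<dots> = (\<Oplus>\<^bsub>U\<^esub> x\<in>?S. f x \<odot>\<^bsub>U\<^esub> h x \<oplus>\<^bsub>U\<^esub> g x \<odot>\<^bsub>U\<^esub> h x)"
      using f g h S by (intro U.M.add.finprod_cong) (auto simp: free_module_sel U.smult_l_distr simp_implies_def)
    also have "\<dots> = (\<Oplus>\<^bsub>U\<^esub> x\<in>?S. f x \<odot>\<^bsub>U\<^esub> h x) \<oplus>\<^bsub>U\<^esub> (\<Oplus>\<^bsub>U\<^esub> x\<in>?S. g x \<odot>\<^bsub>U\<^esub> h x)"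
      using f g h S by (intro U.M.add.finprod_multf) (auto simp: free_module_sel)
    also have "\<dots> = F f \<oplus>\<^bsub>U\<^esub> F g"
      using ext[OF f S(1) _ S(2)] ext[OF g S(1) _ S(2)] by auto
    finally show "F (f \<oplus>\<^bsub>free_module K X\<^esub> g) = F f \<oplus>\<^bsub>U\<^esub> F g" .
  next
    fix r f assume r: "r \<in> carrier K" and f: "f \<in> carrier (free_module K X)"
    let ?S = "{x. f x \<noteq> \<zero>\<^bsub>K\<^esub>}"
    have c: "r \<odot>\<^bsub>free_module K X\<^esub> f \<in> carrier (free_module K X)" using f r by simp
    have S: "finite ?S" "?S \<subseteq> X" using supp f by auto
    have "F (r \<odot>\<^bsub>free_module K X\<^esub> f) = (\<Oplus>\<^bsub>U\<^esub> x\<in>?S. (r \<otimes>\<^bsub>K\<^esub> f x) \<odot>\<^bsub>U\<^esub> h x)"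
      using r by (subst ext[OF c S(1) _ S(2)]) (auto simp: free_module_sel)
    also have "\<dots> = (\<Oplus>\<^bsub>U\<^esub> x\<in>?S. r \<odot>\<^bsub>U\<^esub> (f x \<odot>\<^bsub>U\<^esub> h x))"
      using f r h S by (intro U.M.add.finprod_cong) (auto simp: free_module_sel U.smult_assoc1 simp_implies_def)
    also have "\<dots> = r \<odot>\<^bsub>U\<^esub> F f" unfolding F_def
      using f r h S by (subst U.finsum_smult_ldistr) (auto simp: free_module_sel)
    finally show "F (r \<odot>\<^bsub>free_module K X\<^esub> f) = r \<odot>\<^bsub>U\<^esub> F f" .
  qed
  moreover have "F (free_gen K x) = h x" if "x \<in> X" for x
  proof -
    have c: "free_gen K x \<in> carrier (free_module K X)" using that by (auto simp: free_module_sel free_gen_def)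
    have "F (free_gen K x) = (\<Oplus>\<^bsub>U\<^esub> y\<in>{x}. free_gen K x y \<odot>\<^bsub>U\<^esub> h y)"
      using that by (intro ext[OF c]) (auto simp: free_gen_def)
    also have "\<dots> = h x" using h[OF that] by (subst U.M.add.finprod_insert) (auto simp: free_gen_def)
    finally show ?thesis .
  qed
  ultimately show ?thesis by blast
qed

lemma free_gen_carrier: "cring K \<Longrightarrow> x \<in> X \<Longrightarrow> free_gen K x \<in> carrier (free_module K X)"
proof -
  assume "cring K" "x \<in> X"
  then interpret cring K by simp
  show ?thesis using \<open>x \<in> X\<close> by (auto simp: free_module_sel free_gen_def)
qed

lemma free_module_induct:
  assumes K: "cring K" and f: "f \<in> carrier (free_module K X)"
    and z: "P \<zero>\<^bsub>free_module K X\<^esub>"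
    and st: "\<And>f c x. f \<in> carrier (free_module K X) \<Longrightarrow> P f \<Longrightarrow> c \<in> carrier K \<Longrightarrow> x \<in> X \<Longrightarrow>
       P (f \<oplus>\<^bsub>free_module K X\<^esub> c \<odot>\<^bsub>free_module K X\<^esub> free_gen K x)"
  shows "P f"
proof -
  interpret cring K by fact
  have "finite {x. f x \<noteq> \<zero>\<^bsub>K\<^esub>}" using f by (simp add: free_module_sel)
  then have "\<forall>f. f \<in> carrier (free_module K X) \<longrightarrow> {x. f x \<noteq> \<zero>\<^bsub>K\<^esub>} \<subseteq> S \<longrightarrow> P f"
    if "S = {x. f x \<noteq> \<zero>\<^bsub>K\<^esub>}" for S unfolding that[symmetric]
  proof (induction S rule: finite_induct)
    case empty
    then show ?case
    proof (intro allI impI)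
      fix f assume "f \<in> carrier (free_module K X)" "{x. f x \<noteq> \<zero>\<^bsub>K\<^esub>} \<subseteq> {}"
      then have "f = \<zero>\<^bsub>free_module K X\<^esub>" by (auto simp: free_module_sel)
      then show "P f" using z by simp
    qed
  next
    case (insert x S)
    show ?case
    proof (intro allI impI)
      fix f assume f: "f \<in> carrier (free_module K X)" and s: "{y. f y \<noteq> \<zero>\<^bsub>K\<^esub>} \<subseteq> insert x S"
      let ?g = "f(x := \<zero>\<^bsub>K\<^esub>)"
      have g: "?g \<in> carrier (free_module K X)"
        using f by (auto simp: free_module_sel elim!: rev_finite_subset)
      have gs: "{y. ?g y \<noteq> \<zero>\<^bsub>K\<^esub>} \<subseteq> S" using s by auto
      have Pg: "P ?g" using insert g gs by blast
      show "P f"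
      proof (cases "x \<in> X")
        case True
        have "f = ?g \<oplus>\<^bsub>free_module K X\<^esub> f x \<odot>\<^bsub>free_module K X\<^esub> free_gen K x"
          using f by (auto simp: free_module_sel free_gen_def)
        then show ?thesis using st[OF g Pg _ True, of "f x"] f by (simp add: free_module_sel)
      next
        case False
        then have "f = ?g" using f by (auto simp: free_module_sel)
        then show ?thesis using Pg by simp
      qed
    qed
  qed
  then show ?thesis using f by blast
qed

lemma hom_span_zero:
  assumes M: "module K M" and U: "module K U" and f: "f \<in> module_hom K M U" and S: "S \<subseteq> carrier M"
    and 0: "\<And>s. s \<in> S \<Longrightarrow> f s = \<zero>\<^bsub>U\<^esub>" and x: "x \<in> LinearCombinations.module.span K M S"
  shows "f x = \<zero>\<^bsub>U\<^esub>"
proof -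
  interpret h: mod_hom K M U f using assms by (auto simp: mod_hom_def mod_hom_axioms_def)
  have sub: "LinearCombinations.submodule K h.ker M" by (rule h.ker_is_submodule)
  have "S \<subseteq> h.ker" using S 0 by (auto simp: h.ker_def)
  then have "h.M.span S \<subseteq> h.ker" by (rule h.M.span_is_subset[OF _ sub])
  then show ?thesis using x by (auto simp: h.ker_def)
qed

locale module_pair = V: module K V + W: module K W for K V W
begin
abbreviation "F \<equiv> free_module K (carrier V \<times> carrier W)"
lemma F_module: "module K F"
  by (rule free_module_is_module[OF V.R.is_cring])

lemma gen_closed: "v \<in> carrier V \<Longrightarrow> w \<in> carrier W \<Longrightarrow> free_gen K (v,w) \<in> carrier F"
  by (rule free_gen_carrier[OF V.R.is_cring]) simp

lemma relations_subset: "tensor_relations K V W \<subseteq> carrier F"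
proof -
  interpret F: module K F by (rule F_module)
  show ?thesis unfolding tensor_relations_def Let_def
  proof (intro Un_least subsetI, goal_cases)
  case (1 x)
  then show ?case
    by (clarify, intro F.M.minus_closed F.M.a_closed gen_closed V.M.a_closed)
next
  case (2 x)
  then show ?case
    by (clarify, intro F.M.minus_closed F.M.a_closed gen_closed W.M.a_closed)
next
  case (3 x)
  then show ?case
    by (clarify, intro F.M.minus_closed F.smult_closed gen_closed V.smult_closed)
next
  case (4 x)
  then show ?case
    by (clarify, intro F.M.minus_closed F.smult_closed gen_closed W.smult_closed)
  qed
qed

lemma null_submodule: "LinearCombinations.submodule K (tensor_null K V W) F"
  unfolding tensor_null_def by (rule module.span_is_submodule[OF F_module relations_subset])

lemmas tensor_quot = module.quotient_module_hom[OF F_module null_submodule, folded tensor_module_def]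

lemma pure_tensor_eq: "pure_tensor K V W v w = tensor_null K V W +>\<^bsub>F\<^esub> free_gen K (v,w)"
  by (simp add: pure_tensor_def)

lemma relations_zero: assumes "x \<in> tensor_relations K V W" 
  shows "tensor_null K V W +>\<^bsub>F\<^esub> x = \<zero>\<^bsub>tensor_module K V W\<^esub>"
proof -
  interpret F: module K F by (rule F_module)
  interpret N: abelian_subgroup "tensor_null K V W" F by (rule F.submodule_abelian[OF null_submodule])
  have "x \<in> tensor_null K V W" unfolding tensor_null_def using F.in_own_span[OF relations_subset] assms by blast
  then show ?thesis using N.a_rcos_const by (simp add: tensor_module_def quotient_module_sel)
qed

lemma pure_tensor_bilinear:
  "v \<in> carrier V \<Longrightarrow> v' \<in> carrier V \<Longrightarrow> w \<in> carrier W \<Longrightarrow>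
    pure_tensor K V W (v \<oplus>\<^bsub>V\<^esub> v') w = pure_tensor K V W v w \<oplus>\<^bsub>tensor_module K V W\<^esub> pure_tensor K V W v' w"
  "v \<in> carrier V \<Longrightarrow> w \<in> carrier W \<Longrightarrow> w' \<in> carrier W \<Longrightarrow>
    pure_tensor K V W v (w \<oplus>\<^bsub>W\<^esub> w') = pure_tensor K V W v w \<oplus>\<^bsub>tensor_module K V W\<^esub> pure_tensor K V W v w'"
  "c \<in> carrier K \<Longrightarrow> v \<in> carrier V \<Longrightarrow> w \<in> carrier W \<Longrightarrow>
    pure_tensor K V W (c \<odot>\<^bsub>V\<^esub> v) w = c \<odot>\<^bsub>tensor_module K V W\<^esub> pure_tensor K V W v w"
  "c \<in> carrier K \<Longrightarrow> v \<in> carrier V \<Longrightarrow> w \<in> carrier W \<Longrightarrow>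
    pure_tensor K V W v (c \<odot>\<^bsub>W\<^esub> w) = c \<odot>\<^bsub>tensor_module K V W\<^esub> pure_tensor K V W v w"
proof -
  interpret F: module K F by (rule F_module)
  interpret T: module K "tensor_module K V W" by (rule tensor_quot(1))
  have eq: "tensor_null K V W +>\<^bsub>F\<^esub> x = tensor_null K V W +>\<^bsub>F\<^esub> y"
    if "x \<in> carrier F" "y \<in> carrier F" "x \<ominus>\<^bsub>F\<^esub> y \<in> tensor_relations K V W" for x y
  proof -
    let ?p = "\<lambda>x. tensor_null K V W +>\<^bsub>F\<^esub> x"
    have "?p x \<ominus>\<^bsub>tensor_module K V W\<^esub> ?p y = \<zero>\<^bsub>tensor_module K V W\<^esub>"
      using F.hom_minus(1)[OF tensor_quot(1,2) that(1,2)] relations_zero[OF that(3)] by simp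
    moreover have "?p x \<in> carrier (tensor_module K V W)" "?p y \<in> carrier (tensor_module K V W)"
      using tensor_quot(3) that by auto
    ultimately show ?thesis by (simp add: T.M.minus_zero_iff)
  qed
  note hom = module_hom_add[OF tensor_quot(2)] module_hom_smult[OF tensor_quot(2)]
  {
    fix v v' w assume *: "v \<in> carrier V" "v' \<in> carrier V" "w \<in> carrier W"
    have "free_gen K (v \<oplus>\<^bsub>V\<^esub> v', w) \<ominus>\<^bsub>F\<^esub> (free_gen K (v, w) \<oplus>\<^bsub>F\<^esub> free_gen K (v', w))
        \<in> tensor_relations K V W"
      unfolding tensor_relations_def Let_def using * by blast
    then have "pure_tensor K V W (v \<oplus>\<^bsub>V\<^esub> v') w
        = tensor_null K V W +>\<^bsub>F\<^esub> (free_gen K (v, w) \<oplus>\<^bsub>F\<^esub> free_gen K (v', w))"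
      unfolding pure_tensor_eq using * by (intro eq gen_closed F.M.a_closed V.M.a_closed)
    also have "\<dots> = pure_tensor K V W v w \<oplus>\<^bsub>tensor_module K V W\<^esub> pure_tensor K V W v' w"
      unfolding pure_tensor_eq using * by (intro hom gen_closed)
    finally show "pure_tensor K V W (v \<oplus>\<^bsub>V\<^esub> v') w
      = pure_tensor K V W v w \<oplus>\<^bsub>tensor_module K V W\<^esub> pure_tensor K V W v' w" .
  next
    fix v w w' assume *: "v \<in> carrier V" "w \<in> carrier W" "w' \<in> carrier W"
    have "free_gen K (v, w \<oplus>\<^bsub>W\<^esub> w') \<ominus>\<^bsub>F\<^esub> (free_gen K (v, w) \<oplus>\<^bsub>F\<^esub> free_gen K (v, w'))
        \<in> tensor_relations K V W"
      unfolding tensor_relations_def Let_def using * by blast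
    then have "pure_tensor K V W v (w \<oplus>\<^bsub>W\<^esub> w')
        = tensor_null K V W +>\<^bsub>F\<^esub> (free_gen K (v, w) \<oplus>\<^bsub>F\<^esub> free_gen K (v, w'))"
      unfolding pure_tensor_eq using * by (intro eq gen_closed F.M.a_closed W.M.a_closed)
    also have "\<dots> = pure_tensor K V W v w \<oplus>\<^bsub>tensor_module K V W\<^esub> pure_tensor K V W v w'"
      unfolding pure_tensor_eq using * by (intro hom gen_closed)
    finally show "pure_tensor K V W v (w \<oplus>\<^bsub>W\<^esub> w')
      = pure_tensor K V W v w \<oplus>\<^bsub>tensor_module K V W\<^esub> pure_tensor K V W v w'" .
  next
    fix c v w assume *: "c \<in> carrier K" "v \<in> carrier V" "w \<in> carrier W"
    have "free_gen K (c \<odot>\<^bsub>V\<^esub> v, w) \<ominus>\<^bsub>F\<^esub> c \<odot>\<^bsub>F\<^esub> free_gen K (v, w) \<in> tensor_relations K V W"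
      unfolding tensor_relations_def Let_def using * by blast
    then have "pure_tensor K V W (c \<odot>\<^bsub>V\<^esub> v) w = tensor_null K V W +>\<^bsub>F\<^esub> (c \<odot>\<^bsub>F\<^esub> free_gen K (v, w))"
      unfolding pure_tensor_eq using * by (intro eq gen_closed F.smult_closed V.smult_closed)
    also have "\<dots> = c \<odot>\<^bsub>tensor_module K V W\<^esub> pure_tensor K V W v w"
      unfolding pure_tensor_eq using * by (intro hom gen_closed)
    finally show "pure_tensor K V W (c \<odot>\<^bsub>V\<^esub> v) w
      = c \<odot>\<^bsub>tensor_module K V W\<^esub> pure_tensor K V W v w" .
  next
    fix c v w assume *: "c \<in> carrier K" "v \<in> carrier V" "w \<in> carrier W"
    have "free_gen K (v, c \<odot>\<^bsub>W\<^esub> w) \<ominus>\<^bsub>F\<^esub> c \<odot>\<^bsub>F\<^esub> free_gen K (v, w) \<in> tensor_relations K V W"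
      unfolding tensor_relations_def Let_def using * by blast
    then have "pure_tensor K V W v (c \<odot>\<^bsub>W\<^esub> w) = tensor_null K V W +>\<^bsub>F\<^esub> (c \<odot>\<^bsub>F\<^esub> free_gen K (v, w))"
      unfolding pure_tensor_eq using * by (intro eq gen_closed F.smult_closed W.smult_closed)
    also have "\<dots> = c \<odot>\<^bsub>tensor_module K V W\<^esub> pure_tensor K V W v w"
      unfolding pure_tensor_eq using * by (intro hom gen_closed)
    finally show "pure_tensor K V W v (c \<odot>\<^bsub>W\<^esub> w)
      = c \<odot>\<^bsub>tensor_module K V W\<^esub> pure_tensor K V W v w" .
  }
qed

lemma tensor_hom_eqI:
  assumes U: "module K U" and f: "f \<in> module_hom K (tensor_module K V W) U"
    and f': "f' \<in> module_hom K (tensor_module K V W) U"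
    and eq: "\<And>v w. v \<in> carrier V \<Longrightarrow> w \<in> carrier W \<Longrightarrow> f (pure_tensor K V W v w) = f' (pure_tensor K V W v w)"
    and x: "x \<in> carrier (tensor_module K V W)"
  shows "f x = f' x"
proof -
  interpret F: module K F by (rule F_module)
  interpret T: module K "tensor_module K V W" by (rule tensor_quot(1))
  let ?p = "\<lambda>x. tensor_null K V W +>\<^bsub>F\<^esub> x"
  obtain y where y: "y \<in> carrier F" "x = ?p y" using x tensor_quot(3) by auto
  have "f (?p y) = f' (?p y)"
  proof (rule free_module_induct[OF V.R.is_cring y(1)], goal_cases)
    case 1
    then show ?case
      using F.hom_minus(2)[OF tensor_quot(1,2) y(1) y(1)] T.hom_minus(2)[OF U f x x] T.hom_minus(2)[OF U f' x x] by simp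
  next
    case (2 g' c u)
    obtain v w where u: "u = (v,w)" "v \<in> carrier V" "w \<in> carrier W" using 2 by auto
    have gc: "free_gen K u \<in> carrier F" using gen_closed u by simp
    have c1: "?p g' \<in> carrier (tensor_module K V W)" "?p (free_gen K u) \<in> carrier (tensor_module K V W)"
      using tensor_quot(3) 2 gc by auto
    have "f (?p (free_gen K u)) = f' (?p (free_gen K u))" using eq u by (simp add: pure_tensor_eq)
    then show ?case using 2 gc c1
      by (simp add: module_hom_add[OF tensor_quot(2)] module_hom_smult[OF tensor_quot(2)] 
         module_hom_add[OF f] module_hom_smult[OF f] module_hom_add[OF f'] module_hom_smult[OF f'])
  qed
  then show ?thesis using y by simp
qed

lemma tensor_lift_universal:
  assumes U: "module K U"
    and c: "\<And>v w. v \<in> carrier V \<Longrightarrow> w \<in> carrier W \<Longrightarrow> h v w \<in> carrier U"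
    and h1: "\<And>v v' w. v \<in> carrier V \<Longrightarrow> v' \<in> carrier V \<Longrightarrow> w \<in> carrier W \<Longrightarrow>
       h (v \<oplus>\<^bsub>V\<^esub> v') w = h v w \<oplus>\<^bsub>U\<^esub> h v' w"
    and h2: "\<And>v w w'. v \<in> carrier V \<Longrightarrow> w \<in> carrier W \<Longrightarrow> w' \<in> carrier W \<Longrightarrow>
       h v (w \<oplus>\<^bsub>W\<^esub> w') = h v w \<oplus>\<^bsub>U\<^esub> h v w'"
    and h3: "\<And>c v w. c \<in> carrier K \<Longrightarrow> v \<in> carrier V \<Longrightarrow> w \<in> carrier W \<Longrightarrow>
       h (c \<odot>\<^bsub>V\<^esub> v) w = c \<odot>\<^bsub>U\<^esub> h v w"
    and h4: "\<And>c v w. c \<in> carrier K \<Longrightarrow> v \<in> carrier V \<Longrightarrow> w \<in> carrier W \<Longrightarrow>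
       h v (c \<odot>\<^bsub>W\<^esub> w) = c \<odot>\<^bsub>U\<^esub> h v w"
  shows "tensor_lift K V W U h \<in> module_hom K (tensor_module K V W) U"
   and "\<forall>v\<in>carrier V. \<forall>w\<in>carrier W. tensor_lift K V W U h (pure_tensor K V W v w) = h v w"
proof -
  interpret U: module K U by fact
  interpret F: module K F by (rule F_module)
  interpret T: module K "tensor_module K V W" by (rule tensor_quot(1))
  obtain f where f: "f \<in> module_hom K F U" and 
     fe: "\<And>v w. v \<in> carrier V \<Longrightarrow> w \<in> carrier W \<Longrightarrow> f (free_gen K (v,w)) = h v w"
    using free_module_lift[OF U, of "carrier V \<times> carrier W" "case_prod h"] c by auto
  note fs = F.hom_minus(1)[OF U f] module_hom_add[OF f] module_hom_smult[OF f] fe gen_closed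
  have "f x = \<zero>\<^bsub>U\<^esub>" if "x \<in> tensor_relations K V W" for x
    using that unfolding tensor_relations_def Let_def
    by (auto simp: fs h1 h2 h3 h4 U.M.minus_zero_iff c)
  then have "f n = \<zero>\<^bsub>U\<^esub>" if "n \<in> tensor_null K V W" for n
    using hom_span_zero[OF F.module_axioms U f relations_subset _ that[unfolded tensor_null_def]] by blast
  then obtain k where k: "k \<in> module_hom K (tensor_module K V W) U" 
    "\<And>x. x \<in> carrier F \<Longrightarrow> k (tensor_null K V W +>\<^bsub>F\<^esub> x) = f x"
    using F.quotient_module_lift[OF null_submodule U f, folded tensor_module_def] by blast
  let ?T = "tensor_module K V W"
  have "\<exists>!f. f \<in> module_hom K ?T U \<and> f \<in> extensional (carrier ?T)
      \<and> (\<forall>v\<in>carrier V. \<forall>w\<in>carrier W. f (pure_tensor K V W v w) = h v w)"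
  proof (rule ex1I[of _ "restrict k (carrier ?T)"], intro conjI ballI)
    show "restrict k (carrier ?T) \<in> module_hom K ?T U"
      using k(1) by (auto simp: module_hom_def)
    show "restrict k (carrier ?T) \<in> extensional (carrier ?T)" by simp
    fix v w assume "v \<in> carrier V" "w \<in> carrier W"
    then show "restrict k (carrier ?T) (pure_tensor K V W v w) = h v w"
      using tensor_quot(3) gen_closed by (auto simp: pure_tensor_eq k fe)
  next
    fix f assume f: "f \<in> module_hom K ?T U \<and> f \<in> extensional (carrier ?T)
      \<and> (\<forall>v\<in>carrier V. \<forall>w\<in>carrier W. f (pure_tensor K V W v w) = h v w)"
    then have f1: "f \<in> module_hom K ?T U" and f2: "f \<in> extensional (carrier ?T)"
      and f3: "\<And>v w. v \<in> carrier V \<Longrightarrow> w \<in> carrier W \<Longrightarrow> f (pure_tensor K V W v w) = h v w" by auto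
    have "f (pure_tensor K V W v w) = k (pure_tensor K V W v w)"
      if "v \<in> carrier V" "w \<in> carrier W" for v w
      using that by (simp add: f3 pure_tensor_eq[of v w, symmetric] k(2)[OF gen_closed, folded pure_tensor_eq] fe)
    note fk = tensor_hom_eqI[OF U f1 k(1) this]
    show "f = restrict k (carrier ?T)"
      by (rule extensionalityI[OF f2 restrict_extensional]) (simp add: fk)
  qed
  from theI'[OF this, folded tensor_lift_def]
  show "tensor_lift K V W U h \<in> module_hom K (tensor_module K V W) U"
   and "\<forall>v\<in>carrier V. \<forall>w\<in>carrier W. tensor_lift K V W U h (pure_tensor K V W v w) = h v w"
    by auto
qed
end

lemma module_hom_plus:
  assumes M: "module K M" and U: "module K U" and f: "f \<in> module_hom K M U" and g: "g \<in> module_hom K M U"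
  shows "(\<lambda>x. f x \<oplus>\<^bsub>U\<^esub> g x) \<in> module_hom K M U"
proof -
  interpret M: module K M by fact
  interpret U: module K U by fact
  have "f x \<in> carrier U" "g x \<in> carrier U" if "x \<in> carrier M" for x 
    using f g that by (auto simp: module_hom_def)
  then show ?thesis using f g
    by (auto simp: module_hom_def U.smult_r_distr U.M.a_ac)
qed

lemma module_hom_scale:
  assumes M: "module K M" and U: "module K U" and f: "f \<in> module_hom K M U" and c: "c \<in> carrier K"
  shows "(\<lambda>x. c \<odot>\<^bsub>U\<^esub> f x) \<in> module_hom K M U"
proof -
  interpret M: module K M by fact
  interpret U: module K U by fact
  have "f x \<in> carrier U" if "x \<in> carrier M" for x 
    using f that by (auto simp: module_hom_def)
  then show ?thesis using f c
    by (auto simp: module_hom_def U.smult_r_distr U.smult_assoc1[symmetric] comm_monoid.m_comm[OF cring.axioms(2)[OF module.axioms(1)[OF M]]])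
qed

context module_pair begin
lemma pure_tensor_closed:
  "v \<in> carrier V \<Longrightarrow> w \<in> carrier W \<Longrightarrow> pure_tensor K V W v w \<in> carrier (tensor_module K V W)"
  using tensor_quot(3) gen_closed by (auto simp: pure_tensor_eq)
end

lemma tensor_map_pure_tensor:
  assumes "module K V" "module K W" "module K V'" "module K W'"
    and f: "f \<in> module_hom K V V'" and g: "g \<in> module_hom K W W'"
  shows "tensor_map K V W V' W' f g \<in> module_hom K (tensor_module K V W) (tensor_module K V' W')"
    and "v \<in> carrier V \<Longrightarrow> w \<in> carrier W \<Longrightarrow>
      tensor_map K V W V' W' f g (pure_tensor K V W v w) = pure_tensor K V' W' (f v) (g w)"
proof -
  interpret A: module_pair K V W using assms by (simp add: module_pair_def)
  interpret B: module_pair K V' W' using assms by (simp add: module_pair_def)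
  have c: "v \<in> carrier V \<Longrightarrow> f v \<in> carrier V'" "w \<in> carrier W \<Longrightarrow> g w \<in> carrier W'" for v w
    using f g by (auto simp: module_hom_def)
  note l = A.tensor_lift_universal[OF B.tensor_quot(1), of "\<lambda>v w. pure_tensor K V' W' (f v) (g w)", folded tensor_map_def,
    OF B.pure_tensor_closed]
  have *: "tensor_map K V W V' W' f g \<in> module_hom K (tensor_module K V W) (tensor_module K V' W') \<and>
    (\<forall>v\<in>carrier V. \<forall>w\<in>carrier W. tensor_map K V W V' W' f g (pure_tensor K V W v w) = pure_tensor K V' W' (f v) (g w))"
    by (intro conjI l) (auto simp: c B.pure_tensor_bilinear 
       module_hom_add[OF f] module_hom_smult[OF f] module_hom_add[OF g] module_hom_smult[OF g])
  then show "tensor_map K V W V' W' f g \<in> module_hom K (tensor_module K V W) (tensor_module K V' W')"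
    and "v \<in> carrier V \<Longrightarrow> w \<in> carrier W \<Longrightarrow>
      tensor_map K V W V' W' f g (pure_tensor K V W v w) = pure_tensor K V' W' (f v) (g w)" by blast+
qed

lemma tensor_assoc_pure_tensor:
  assumes "module K U" "module K V" "module K W"
  defines "UV \<equiv> tensor_module K U V" and "VW \<equiv> tensor_module K V W"
  shows "tensor_assoc K U V W \<in> module_hom K (tensor_module K UV W) (tensor_module K U VW)" (is ?A)
    and "u \<in> carrier U \<Longrightarrow> v \<in> carrier V \<Longrightarrow> w \<in> carrier W \<Longrightarrow>
      tensor_assoc K U V W (pure_tensor K UV W (pure_tensor K U V u v) w)
        = pure_tensor K U VW u (pure_tensor K V W v w)" (is "_ \<Longrightarrow> _ \<Longrightarrow> _ \<Longrightarrow> ?B")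
proof -
  interpret A: module_pair K U V using assms by (simp add: module_pair_def)
  interpret B: module_pair K V W using assms by (simp add: module_pair_def)
  interpret C: module_pair K UV W using assms A.tensor_quot(1) by (simp add: module_pair_def)
  interpret D: module_pair K U VW using assms B.tensor_quot(1) by (simp add: module_pair_def)
  let ?T = "tensor_module K U VW"
  let ?h = "\<lambda>w u v. pure_tensor K U VW u (pure_tensor K V W v w)"
  interpret T: module K ?T by (rule D.tensor_quot)
  have c: "v \<in> carrier V \<Longrightarrow> w \<in> carrier W \<Longrightarrow> pure_tensor K V W v w \<in> carrier VW" for v w
    unfolding VW_def by (rule B.pure_tensor_closed)
  note b = B.pure_tensor_bilinear[folded VW_def]
  have "tensor_lift K U V ?T (?h w) \<in> module_hom K UV ?T \<and> (\<forall>u\<in>carrier U. \<forall>v\<in>carrier V.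
     tensor_lift K U V ?T (?h w) (pure_tensor K U V u v) = ?h w u v)" if w: "w \<in> carrier W" for w
    unfolding UV_def
    by (intro conjI A.tensor_lift_universal D.tensor_quot(1))
      (auto simp: w c b D.pure_tensor_bilinear D.pure_tensor_closed)
  then have l: "w \<in> carrier W \<Longrightarrow> tensor_lift K U V ?T (?h w) \<in> module_hom K UV ?T"
    "w \<in> carrier W \<Longrightarrow> u\<in>carrier U \<Longrightarrow> v\<in>carrier V \<Longrightarrow>
     tensor_lift K U V ?T (?h w) (pure_tensor K U V u v) = ?h w u v" for w u v by blast+
  have lc: "w \<in> carrier W \<Longrightarrow> t \<in> carrier UV \<Longrightarrow> tensor_lift K U V ?T (?h w) t \<in> carrier ?T" for w t
    by (rule funcset_mem[OF module_hom_closed[OF l(1)]])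
  have e: "tensor_assoc K U V W = tensor_lift K UV W ?T (\<lambda>t w. tensor_lift K U V ?T (?h w) t)"
    by (simp add: tensor_assoc_def Let_def UV_def VW_def)
  have "?A \<and> (\<forall>t\<in>carrier UV. \<forall>w\<in>carrier W. 
     tensor_assoc K U V W (pure_tensor K UV W t w) = tensor_lift K U V ?T (?h w) t)" unfolding e
  proof (intro conjI C.tensor_lift_universal D.tensor_quot(1), goal_cases)
    case (3 t w w')
    show ?case
      by (rule A.tensor_hom_eqI[OF D.tensor_quot(1), folded UV_def, OF l(1) module_hom_plus])
        (use 3 in \<open>auto simp: l b D.pure_tensor_bilinear c C.V.module_axioms T.module_axioms\<close>)
  next
    case (8 t w w')
    show ?case
      by (rule A.tensor_hom_eqI[OF D.tensor_quot(1), folded UV_def, OF l(1) module_hom_plus])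
        (use 8 in \<open>auto simp: l b D.pure_tensor_bilinear c C.V.module_axioms T.module_axioms\<close>)
  next
    case (5 d t w)
    show ?case
      by (rule A.tensor_hom_eqI[OF D.tensor_quot(1), folded UV_def, OF l(1) module_hom_scale])
        (use 5 in \<open>auto simp: l b D.pure_tensor_bilinear c C.V.module_axioms T.module_axioms\<close>)
  next
    case (10 d t w)
    show ?case
      by (rule A.tensor_hom_eqI[OF D.tensor_quot(1), folded UV_def, OF l(1) module_hom_scale])
        (use 10 in \<open>auto simp: l b D.pure_tensor_bilinear c C.V.module_axioms T.module_axioms\<close>)
  qed (auto simp: lc module_hom_add[OF l(1)] module_hom_smult[OF l(1)])
  then show ?A "u \<in> carrier U \<Longrightarrow> v \<in> carrier V \<Longrightarrow> w \<in> carrier W \<Longrightarrow> ?B"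
    using A.pure_tensor_closed[folded UV_def] by (auto simp: l(2))
qed

lemma tensor_assoc_inv_pure_tensor:
  assumes "module K U" "module K V" "module K W"
  defines "UV \<equiv> tensor_module K U V" and "VW \<equiv> tensor_module K V W"
  shows "tensor_assoc_inv K U V W \<in> module_hom K (tensor_module K U VW) (tensor_module K UV W)" (is ?A)
    and "u \<in> carrier U \<Longrightarrow> v \<in> carrier V \<Longrightarrow> w \<in> carrier W \<Longrightarrow>
      tensor_assoc_inv K U V W (pure_tensor K U VW u (pure_tensor K V W v w))
        = pure_tensor K UV W (pure_tensor K U V u v) w" (is "_ \<Longrightarrow> _ \<Longrightarrow> _ \<Longrightarrow> ?B")
proof -
  interpret A: module_pair K U V using assms by (simp add: module_pair_def)
  interpret B: module_pair K V W using assms by (simp add: module_pair_def)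
  interpret C: module_pair K UV W using assms A.tensor_quot(1) by (simp add: module_pair_def)
  interpret D: module_pair K U VW using assms B.tensor_quot(1) by (simp add: module_pair_def)
  let ?T = "tensor_module K UV W"
  let ?h = "\<lambda>u v w. pure_tensor K UV W (pure_tensor K U V u v) w"
  interpret T: module K ?T by (rule C.tensor_quot)
  have c: "u \<in> carrier U \<Longrightarrow> v \<in> carrier V \<Longrightarrow> pure_tensor K U V u v \<in> carrier UV" for u v
    unfolding UV_def by (rule A.pure_tensor_closed)
  note b = A.pure_tensor_bilinear[folded UV_def]
  have "tensor_lift K V W ?T (?h u) \<in> module_hom K VW ?T \<and> (\<forall>v\<in>carrier V. \<forall>w\<in>carrier W.
     tensor_lift K V W ?T (?h u) (pure_tensor K V W v w) = ?h u v w)" if u: "u \<in> carrier U" for u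
    unfolding VW_def
    by (intro conjI B.tensor_lift_universal C.tensor_quot(1))
      (auto simp: u c b C.pure_tensor_bilinear C.pure_tensor_closed)
  then have l: "u \<in> carrier U \<Longrightarrow> tensor_lift K V W ?T (?h u) \<in> module_hom K VW ?T"
    "w \<in> carrier W \<Longrightarrow> u\<in>carrier U \<Longrightarrow> v\<in>carrier V \<Longrightarrow>
     tensor_lift K V W ?T (?h u) (pure_tensor K V W v w) = ?h u v w" for w u v by blast+
  have lc: "u \<in> carrier U \<Longrightarrow> t \<in> carrier VW \<Longrightarrow> tensor_lift K V W ?T (?h u) t \<in> carrier ?T" for u t
    by (rule funcset_mem[OF module_hom_closed[OF l(1)]])
  have e: "tensor_assoc_inv K U V W = tensor_lift K U VW ?T (\<lambda>u t. tensor_lift K V W ?T (?h u) t)"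
    by (simp add: tensor_assoc_inv_def Let_def UV_def VW_def)
  have "?A \<and> (\<forall>u\<in>carrier U. \<forall>t\<in>carrier VW. 
     tensor_assoc_inv K U V W (pure_tensor K U VW u t) = tensor_lift K V W ?T (?h u) t)" unfolding e
  proof (intro conjI D.tensor_lift_universal C.tensor_quot(1), goal_cases)
    case (2 u u' t)
    show ?case
      by (rule B.tensor_hom_eqI[OF C.tensor_quot(1), folded VW_def, OF l(1) module_hom_plus])
        (use 2 in \<open>auto simp: l b C.pure_tensor_bilinear c D.W.module_axioms T.module_axioms\<close>)
  next
    case (7 u u' t)
    show ?case
      by (rule B.tensor_hom_eqI[OF C.tensor_quot(1), folded VW_def, OF l(1) module_hom_plus])
        (use 7 in \<open>auto simp: l b C.pure_tensor_bilinear c D.W.module_axioms T.module_axioms\<close>)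
  next
    case (4 d u t)
    show ?case
      by (rule B.tensor_hom_eqI[OF C.tensor_quot(1), folded VW_def, OF l(1) module_hom_scale])
        (use 4 in \<open>auto simp: l b C.pure_tensor_bilinear c D.W.module_axioms T.module_axioms\<close>)
  next
    case (9 d u t)
    show ?case
      by (rule B.tensor_hom_eqI[OF C.tensor_quot(1), folded VW_def, OF l(1) module_hom_scale])
        (use 9 in \<open>auto simp: l b C.pure_tensor_bilinear c D.W.module_axioms T.module_axioms\<close>)
  qed (auto simp: lc module_hom_add[OF l(1)] module_hom_smult[OF l(1)])
  then show ?A "u \<in> carrier U \<Longrightarrow> v \<in> carrier V \<Longrightarrow> w \<in> carrier W \<Longrightarrow> ?B"
    using B.pure_tensor_closed[folded VW_def] by (auto simp: l(2))
qed

lemma (in nonassoc_algebra) R_map_pure_tensor: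
  assumes "\<alpha> \<in> carrier K" "\<beta> \<in> carrier K" "z \<in> carrier A"
  defines "AA \<equiv> tensor_module K A A"
  shows "R_map K A \<alpha> \<beta> z \<in> module_hom K AA AA" (is ?A)
    and "a \<in> carrier A \<Longrightarrow> b \<in> carrier A \<Longrightarrow> R_map K A \<alpha> \<beta> z (pure_tensor K A A a b)
      = \<alpha> \<odot>\<^bsub>AA\<^esub> pure_tensor K A A b a \<oplus>\<^bsub>AA\<^esub> \<beta> \<odot>\<^bsub>AA\<^esub> pure_tensor K A A z (a \<otimes>\<^bsub>A\<^esub> b)"
proof -
  interpret P: module_pair K A A using module_axioms by (simp add: module_pair_def)
  interpret T: module K AA using P.tensor_quot by (simp add: AA_def)
  note c = P.pure_tensor_closed[folded AA_def] 
  note simps = c P.pure_tensor_bilinear[folded AA_def] mult_closed assms(1-3) mult_add_left mult_add_right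
    mult_smult_left mult_smult_right T.smult_r_distr T.smult_assoc1[symmetric]
  have *: "?A \<and> (\<forall>a\<in>carrier A. \<forall>b\<in>carrier A. R_map K A \<alpha> \<beta> z (pure_tensor K A A a b)
      = \<alpha> \<odot>\<^bsub>AA\<^esub> pure_tensor K A A b a \<oplus>\<^bsub>AA\<^esub> \<beta> \<odot>\<^bsub>AA\<^esub> pure_tensor K A A z (a \<otimes>\<^bsub>A\<^esub> b))"
    unfolding R_map_def Let_def AA_def[symmetric]
    by (intro conjI P.tensor_lift_universal[folded AA_def] T.module_axioms)
      (auto simp: simps T.M.a_ac comm_monoid.m_comm[OF cring.axioms(2)[OF module.axioms(1)[OF module_axioms]]])
  then show ?A "a \<in> carrier A \<Longrightarrow> b \<in> carrier A \<Longrightarrow> R_map K A \<alpha> \<beta> z (pure_tensor K A A a b)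
      = \<alpha> \<odot>\<^bsub>AA\<^esub> pure_tensor K A A b a \<oplus>\<^bsub>AA\<^esub> \<beta> \<odot>\<^bsub>AA\<^esub> pure_tensor K A A z (a \<otimes>\<^bsub>A\<^esub> b)"
    by blast+
qed

end

theory Submission
  imports Defs
begin

text \<open>Write products by juxtaposition. Since both composites are linear, the Yang-Baxter
  equation need only be tested on pure tensors \<open>a \<otimes> b \<otimes> c\<close>
  (\<open>tensor_triple_hom_eqI\<close>). Expanding there, every term that contains a product with
  the central element \<open>z\<close> vanishes. Both sides then share one term with coefficient
  \<open>\<alpha>\<^sup>3\<close>, namely \<open>c \<otimes> b \<otimes> a\<close>, and three terms
  with coefficient \<open>\<alpha>\<^sup>2\<beta>\<close>. What is left is
  \<open>\<alpha>\<beta>\<^sup>2 z \<otimes> z \<otimes> (ab)c\<close> on one side and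
  \<open>\<alpha>\<beta>\<^sup>2 z \<otimes> z \<otimes> (a(bc) + (ac)b)\<close> on the other.

  The equation is therefore the Leibniz identity, provided that \<open>x \<mapsto>
  \<alpha>\<beta>\<^sup>2 z \<otimes> z \<otimes> x\<close> is injective. This is where the field
  and the nonvanishing of \<alpha>, \<beta> and \<open>z\<close> enter: over a field a pure tensor
  of nonzero vectors is nonzero (\<open>pure_tensor_eq_zeroD\<close>), because some linear
  functional takes the value 1 at a given nonzero vector (\<open>exists_linear_functional\<close>,
  by Zorn's lemma). Together this gives \<open>qybe_solution_iff_leibniz\<close>.

  In a Jacobi-Jordan algebra the Leibniz identity amounts to \<open>2 c(ab) = 0\<close> for all
  \<open>a\<close>, \<open>b\<close>, \<open>c\<close>. Either 2 = 0 in the field, or all products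
  \<open>c(ab)\<close> vanish, and the latter says that the third term of the lower central series
  is zero (\<open>at_most_3_step_nilpotent_iff\<close>).\<close>

section \<open>Linear functionals on a vector space of arbitrary dimension\<close>

context vectorspace
begin

text \<open>Zorn's lemma applies because the union of a nonempty chain of subspaces is a subspace.
  The maximal \<open>M\<close> will be the kernel of a functional that does not vanish at
  \<open>v\<close>.\<close>

lemma exists_maximal_subspace_avoiding:
  assumes "v \<in> carrier V" "v \<noteq> \<zero>\<^bsub>V\<^esub>"
  obtains M where "LinearCombinations.submodule K M V" "v \<notin> M"
    "\<And>N. LinearCombinations.submodule K N V \<Longrightarrow> v \<notin> N \<Longrightarrow> M \<subseteq> N \<Longrightarrow> N = M"
proof -
  let ?S = "{N. LinearCombinations.submodule K N V \<and> v \<notin> N}"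
  have "\<exists>M\<in>?S. \<forall>X\<in>?S. M \<subseteq> X \<longrightarrow> X = M"
  proof (rule subset_Zorn_nonempty)
    have "{\<zero>\<^bsub>V\<^esub>} \<in> ?S"
      using assms module_axioms by (auto simp: LinearCombinations.submodule_def)
    then show "?S \<noteq> {}" by blast
  next
    fix C assume ne: "C \<noteq> {}" and ch: "subset.chain ?S C"
    have sub: "LinearCombinations.submodule K N V" "v \<notin> N" if "N \<in> C" for N
      using ch that by (auto simp: subset_chain_def)
    have "LinearCombinations.submodule K (\<Union>C) V"
    proof (rule LinearCombinations.submodule.intro[OF module_axioms])
      show "\<Union>C \<subseteq> carrier V" using sub(1)[THEN LinearCombinations.submodule.subset] by blast
      show "\<zero>\<^bsub>V\<^esub> \<in> \<Union>C" using ne sub(1)[THEN LinearCombinations.submodule.zero_closed] by blast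
      show "c \<odot>\<^bsub>V\<^esub> x \<in> \<Union>C" if "c \<in> carrier K" "x \<in> \<Union>C" for c x
        using that sub(1) by (auto simp: LinearCombinations.submodule_def)
      fix x y assume "x \<in> \<Union>C" "y \<in> \<Union>C"
      then obtain X Y where XY: "X \<in> C" "Y \<in> C" "x \<in> X" "y \<in> Y" by blast
      then have "X \<subseteq> Y \<or> Y \<subseteq> X" using ch by (auto simp: subset_chain_def)
      with XY obtain Z where "Z \<in> C" "x \<in> Z" "y \<in> Z" by blast
      then show "x \<oplus>\<^bsub>V\<^esub> y \<in> \<Union>C"
        using sub(1)[of Z] by (auto simp: LinearCombinations.submodule_def)
    qed
    then show "\<Union>C \<in> ?S" using sub(2) by blast
  qed
  then show ?thesis using that by blast
qed

text \<open>Maximality of \<open>M\<close> forces the whole space to be the direct sum of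
  \<open>M\<close> and the line through \<open>v\<close>; the functional reads off the coefficient
  of \<open>v\<close>.\<close>

lemma exists_linear_functional:
  assumes v: "v \<in> carrier V" "v \<noteq> \<zero>\<^bsub>V\<^esub>"
  obtains \<phi> where "\<phi> \<in> carrier V \<rightarrow> carrier K" "\<phi> v = \<one>\<^bsub>K\<^esub>"
    "\<And>x y. x \<in> carrier V \<Longrightarrow> y \<in> carrier V \<Longrightarrow> \<phi> (x \<oplus>\<^bsub>V\<^esub> y) = \<phi> x \<oplus>\<^bsub>K\<^esub> \<phi> y"
    "\<And>c x. c \<in> carrier K \<Longrightarrow> x \<in> carrier V \<Longrightarrow> \<phi> (c \<odot>\<^bsub>V\<^esub> x) = c \<otimes>\<^bsub>K\<^esub> \<phi> x"
proof -
  obtain M where M: "LinearCombinations.submodule K M V" and vM: "v \<notin> M"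
    and max: "\<And>N. LinearCombinations.submodule K N V \<Longrightarrow> v \<notin> N \<Longrightarrow> M \<subseteq> N \<Longrightarrow> N = M"
    using exists_maximal_subspace_avoiding[OF v] by blast
  interpret M: LinearCombinations.submodule K M V by (rule M)
  have Mc: "m \<in> M \<Longrightarrow> m \<in> carrier V" for m using M.subset by blast
  have Mneg: "\<ominus>\<^bsub>V\<^esub> m \<in> M" if "m \<in> M" for m
    using additive_subgroup.a_inv_closed[OF abelian_subgroup.axioms(1)[OF submodule_abelian[OF M]] that] .
  have smult_inv: "inv\<^bsub>K\<^esub> c \<odot>\<^bsub>V\<^esub> (c \<odot>\<^bsub>V\<^esub> x) = x"
    "inv\<^bsub>K\<^esub> c \<in> carrier K" if "c \<in> carrier K" "c \<noteq> \<zero>\<^bsub>K\<^esub>" "x \<in> carrier V" for c x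
    using that by (auto simp: smult_assoc1[symmetric] field_Units)
  \<comment> \<open>Two different coefficients would put a nonzero multiple of \<open>v\<close>,
    hence \<open>v\<close> itself, into \<open>M\<close>.\<close>
  have uniq: "c = d"
    if "c \<in> carrier K" "d \<in> carrier K" "m \<in> M" "n \<in> M" "m \<oplus>\<^bsub>V\<^esub> c \<odot>\<^bsub>V\<^esub> v = n \<oplus>\<^bsub>V\<^esub> d \<odot>\<^bsub>V\<^esub> v"
    for c d m n
  proof (rule ccontr)
    assume "c \<noteq> d"
    let ?e = "c \<ominus>\<^bsub>K\<^esub> d"
    have e: "?e \<in> carrier K" "?e \<noteq> \<zero>\<^bsub>K\<^esub>" using that(1,2) \<open>c \<noteq> d\<close> by (auto simp: R.minus_zero_iff)
    have "c \<odot>\<^bsub>V\<^esub> v = \<ominus>\<^bsub>V\<^esub> m \<oplus>\<^bsub>V\<^esub> (n \<oplus>\<^bsub>V\<^esub> d \<odot>\<^bsub>V\<^esub> v)"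
      using that(1-4) v Mc by (simp add: that(5)[symmetric] M.r_neg1)
    then have "?e \<odot>\<^bsub>V\<^esub> v = \<ominus>\<^bsub>V\<^esub> m \<oplus>\<^bsub>V\<^esub> n"
      using that(1-4) v Mc by (simp add: a_minus_def smult_l_distr smult_l_minus M.a_assoc M.r_neg)
    then have "?e \<odot>\<^bsub>V\<^esub> v \<in> M" using that Mneg by simp
    then have "inv\<^bsub>K\<^esub> ?e \<odot>\<^bsub>V\<^esub> (?e \<odot>\<^bsub>V\<^esub> v) \<in> M" using smult_inv(2)[OF e v(1)] by simp
    then show False using vM smult_inv(1)[OF e v(1)] by simp
  qed
  have ex: "\<exists>c\<in>carrier K. \<exists>m\<in>M. x = m \<oplus>\<^bsub>V\<^esub> c \<odot>\<^bsub>V\<^esub> v" if x: "x \<in> carrier V" for x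
  proof (cases "x \<in> M")
    case True
    then show ?thesis using v x by (intro bexI[of _ "\<zero>\<^bsub>K\<^esub>"] bexI[of _ x]) auto
  next
    case False
    \<comment> \<open>This is \<open>M\<close> enlarged by the line through \<open>x\<close>. By
      maximality it contains \<open>v\<close>, say \<open>v = m + c x\<close>. Here \<open>c\<close>
      is nonzero as \<open>v\<close> is not in \<open>M\<close>, so the relation can be solved for
      \<open>x\<close>.\<close>
    let ?N = "{m \<oplus>\<^bsub>V\<^esub> c \<odot>\<^bsub>V\<^esub> x | m c. m \<in> M \<and> c \<in> carrier K}"
    have N: "LinearCombinations.submodule K ?N V"
    proof (rule LinearCombinations.submodule.intro[OF module_axioms])
      show "?N \<subseteq> carrier V" using Mc x by auto
      show "\<zero>\<^bsub>V\<^esub> \<in> ?N" using x by (auto intro!: exI[of _ "\<zero>\<^bsub>V\<^esub>"] exI[of _ "\<zero>\<^bsub>K\<^esub>"])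
    next
      fix a b assume "a \<in> ?N" "b \<in> ?N"
      then obtain m c n d where *: "a = m \<oplus>\<^bsub>V\<^esub> c \<odot>\<^bsub>V\<^esub> x" "b = n \<oplus>\<^bsub>V\<^esub> d \<odot>\<^bsub>V\<^esub> x"
        "m \<in> M" "n \<in> M" "c \<in> carrier K" "d \<in> carrier K" by blast
      then have "a \<oplus>\<^bsub>V\<^esub> b = (m \<oplus>\<^bsub>V\<^esub> n) \<oplus>\<^bsub>V\<^esub> (c \<oplus>\<^bsub>K\<^esub> d) \<odot>\<^bsub>V\<^esub> x"
        using Mc x by (simp add: smult_l_distr M.a_ac)
      with * show "a \<oplus>\<^bsub>V\<^esub> b \<in> ?N" by blast
    next
      fix r a assume r: "r \<in> carrier K" and "a \<in> ?N"
      then obtain m c where *: "a = m \<oplus>\<^bsub>V\<^esub> c \<odot>\<^bsub>V\<^esub> x" "m \<in> M" "c \<in> carrier K" by blast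
      then have "r \<odot>\<^bsub>V\<^esub> a = (r \<odot>\<^bsub>V\<^esub> m) \<oplus>\<^bsub>V\<^esub> (r \<otimes>\<^bsub>K\<^esub> c) \<odot>\<^bsub>V\<^esub> x"
        using Mc x r by (simp add: smult_r_distr smult_assoc1)
      with * r show "r \<odot>\<^bsub>V\<^esub> a \<in> ?N" by blast
    qed
    have "x \<in> ?N" using x by (auto intro!: exI[of _ "\<zero>\<^bsub>V\<^esub>"] exI[of _ "\<one>\<^bsub>K\<^esub>"])
    moreover have "M \<subseteq> ?N"
    proof
      fix m assume "m \<in> M"
      then show "m \<in> ?N" using x Mc by (auto intro!: exI[of _ m] exI[of _ "\<zero>\<^bsub>K\<^esub>"])
    qed
    ultimately have "v \<in> ?N" using max[OF N] False by blast
    then obtain m c where mc: "m \<in> M" "c \<in> carrier K" "v = m \<oplus>\<^bsub>V\<^esub> c \<odot>\<^bsub>V\<^esub> x" by blast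
    have c0: "c \<noteq> \<zero>\<^bsub>K\<^esub>" using mc vM x Mc by auto
    note i = smult_inv[OF mc(2) c0 x]
    have "inv\<^bsub>K\<^esub> c \<odot>\<^bsub>V\<^esub> v = inv\<^bsub>K\<^esub> c \<odot>\<^bsub>V\<^esub> m \<oplus>\<^bsub>V\<^esub> x"
      using mc i x Mc by (simp add: smult_r_distr)
    then have "x = \<ominus>\<^bsub>V\<^esub> (inv\<^bsub>K\<^esub> c \<odot>\<^bsub>V\<^esub> m) \<oplus>\<^bsub>V\<^esub> inv\<^bsub>K\<^esub> c \<odot>\<^bsub>V\<^esub> v"
      using mc i x Mc by (simp add: M.r_neg1)
    moreover have "\<ominus>\<^bsub>V\<^esub> (inv\<^bsub>K\<^esub> c \<odot>\<^bsub>V\<^esub> m) \<in> M" by (rule Mneg[OF M.smult_closed[OF i(2) mc(1)]])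
    ultimately show ?thesis using i(2) by blast
  qed
  define \<phi> where "\<phi> x = (THE c. c \<in> carrier K \<and> (\<exists>m\<in>M. x = m \<oplus>\<^bsub>V\<^esub> c \<odot>\<^bsub>V\<^esub> v))" for x
  have \<phi>_eq: "\<phi> (m \<oplus>\<^bsub>V\<^esub> c \<odot>\<^bsub>V\<^esub> v) = c" if "m \<in> M" "c \<in> carrier K" for m c
    unfolding \<phi>_def using that uniq by (intro the_equality) blast+
  show ?thesis
  proof (rule that)
    show "\<phi> \<in> carrier V \<rightarrow> carrier K" using ex \<phi>_eq by fastforce
    show "\<phi> v = \<one>\<^bsub>K\<^esub>" using \<phi>_eq[of "\<zero>\<^bsub>V\<^esub>" "\<one>\<^bsub>K\<^esub>"] v by simp
  next
    fix x y assume "x \<in> carrier V" "y \<in> carrier V"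
    then obtain m c n d where *: "x = m \<oplus>\<^bsub>V\<^esub> c \<odot>\<^bsub>V\<^esub> v" "y = n \<oplus>\<^bsub>V\<^esub> d \<odot>\<^bsub>V\<^esub> v"
      "m \<in> M" "n \<in> M" "c \<in> carrier K" "d \<in> carrier K" using ex by meson
    then have "x \<oplus>\<^bsub>V\<^esub> y = (m \<oplus>\<^bsub>V\<^esub> n) \<oplus>\<^bsub>V\<^esub> (c \<oplus>\<^bsub>K\<^esub> d) \<odot>\<^bsub>V\<^esub> v"
      using Mc v by (simp add: smult_l_distr M.a_ac)
    then show "\<phi> (x \<oplus>\<^bsub>V\<^esub> y) = \<phi> x \<oplus>\<^bsub>K\<^esub> \<phi> y" using * by (simp add: \<phi>_eq)
  next
    fix r x assume r: "r \<in> carrier K" and "x \<in> carrier V"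
    then obtain m c where *: "x = m \<oplus>\<^bsub>V\<^esub> c \<odot>\<^bsub>V\<^esub> v" "m \<in> M" "c \<in> carrier K" using ex by meson
    then have "r \<odot>\<^bsub>V\<^esub> x = (r \<odot>\<^bsub>V\<^esub> m) \<oplus>\<^bsub>V\<^esub> (r \<otimes>\<^bsub>K\<^esub> c) \<odot>\<^bsub>V\<^esub> v"
      using Mc v r by (simp add: smult_r_distr smult_assoc1)
    then show "\<phi> (r \<odot>\<^bsub>V\<^esub> x) = r \<otimes>\<^bsub>K\<^esub> \<phi> x" using * r by (simp add: \<phi>_eq)
  qed
qed

end

section \<open>Pure tensors of nonzero vectors\<close>

context module_pair
begin

lemma pure_tensor_zero:
  "v \<in> carrier V \<Longrightarrow> pure_tensor K V W v \<zero>\<^bsub>W\<^esub> = \<zero>\<^bsub>tensor_module K V W\<^esub>"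
  "w \<in> carrier W \<Longrightarrow> pure_tensor K V W \<zero>\<^bsub>V\<^esub> w = \<zero>\<^bsub>tensor_module K V W\<^esub>"
proof -
  interpret T: module K "tensor_module K V W" by (rule tensor_quot(1))
  show "v \<in> carrier V \<Longrightarrow> pure_tensor K V W v \<zero>\<^bsub>W\<^esub> = \<zero>\<^bsub>tensor_module K V W\<^esub>"
    using pure_tensor_bilinear(4)[of "\<zero>\<^bsub>K\<^esub>" v "\<zero>\<^bsub>W\<^esub>"] by (simp add: pure_tensor_closed)
  show "w \<in> carrier W \<Longrightarrow> pure_tensor K V W \<zero>\<^bsub>V\<^esub> w = \<zero>\<^bsub>tensor_module K V W\<^esub>"
    using pure_tensor_bilinear(3)[of "\<zero>\<^bsub>K\<^esub>" "\<zero>\<^bsub>V\<^esub>" w] by (simp add: pure_tensor_closed)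
qed

text \<open>For a functional \<open>\<phi>\<close> with \<open>\<phi> v = 1\<close>, the map \<open>x \<otimes> y \<mapsto> \<phi> x y\<close> sends \<open>v \<otimes> w\<close> to \<open>w\<close>.\<close>

lemma pure_tensor_eq_zeroD:
  assumes K: "field K" and v: "v \<in> carrier V" "v \<noteq> \<zero>\<^bsub>V\<^esub>" and w: "w \<in> carrier W"
    and 0: "pure_tensor K V W v w = \<zero>\<^bsub>tensor_module K V W\<^esub>"
  shows "w = \<zero>\<^bsub>W\<^esub>"
proof -
  interpret vs: vectorspace K V using K V.module_axioms by (simp add: vectorspace_def)
  interpret T: module K "tensor_module K V W" by (rule tensor_quot(1))
  obtain \<phi> where \<phi>: "\<phi> \<in> carrier V \<rightarrow> carrier K" "\<phi> v = \<one>\<^bsub>K\<^esub>"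
    "\<And>x y. x \<in> carrier V \<Longrightarrow> y \<in> carrier V \<Longrightarrow> \<phi> (x \<oplus>\<^bsub>V\<^esub> y) = \<phi> x \<oplus>\<^bsub>K\<^esub> \<phi> y"
    "\<And>c x. c \<in> carrier K \<Longrightarrow> x \<in> carrier V \<Longrightarrow> \<phi> (c \<odot>\<^bsub>V\<^esub> x) = c \<otimes>\<^bsub>K\<^esub> \<phi> x"
    using vs.exists_linear_functional[OF v] by blast
  have \<phi>c: "x \<in> carrier V \<Longrightarrow> \<phi> x \<in> carrier K" for x using \<phi>(1) by blast
  let ?f = "tensor_lift K V W W (\<lambda>x y. \<phi> x \<odot>\<^bsub>W\<^esub> y)"
  have "?f \<in> module_hom K (tensor_module K V W) W \<and>
      (\<forall>x\<in>carrier V. \<forall>y\<in>carrier W. ?f (pure_tensor K V W x y) = \<phi> x \<odot>\<^bsub>W\<^esub> y)"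
    by (intro conjI tensor_lift_universal W.module_axioms)
      (auto simp: \<phi>(3,4) \<phi>c W.smult_l_distr W.smult_r_distr W.smult_assoc1[symmetric] V.R.m_comm)
  then have f: "?f \<in> module_hom K (tensor_module K V W) W" "?f (pure_tensor K V W v w) = w"
    using v w \<phi>(2) by auto
  have "?f \<zero>\<^bsub>tensor_module K V W\<^esub> = \<zero>\<^bsub>W\<^esub>"
    by (rule T.hom_minus(2)[OF W.module_axioms f(1) T.M.zero_closed T.M.zero_closed])
  then show ?thesis using f(2) 0 by simp
qed

end

section \<open>Linear maps on threefold tensor products\<close>

lemma module_hom_id: "(\<lambda>x. x) \<in> module_hom K M M"
  by (simp add: module_hom_def)

lemma module_hom_comp:
  "f \<in> module_hom K M N \<Longrightarrow> g \<in> module_hom K N P \<Longrightarrow> (\<lambda>x. g (f x)) \<in> module_hom K M P"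
  by (auto simp: module_hom_def Pi_iff)

text \<open>Uniqueness for twofold tensor products is used twice: for fixed \<open>w\<close> the map
  \<open>s \<mapsto> s \<otimes> w\<close> is linear, so agreement extends from pure
  \<open>s\<close> to all \<open>s\<close>, and then to all of the threefold product.\<close>

lemma tensor_triple_hom_eqI:
  assumes mods: "module K U" "module K V" "module K W" and X: "module K X"
  defines "UV \<equiv> tensor_module K U V"
  defines "T \<equiv> tensor_module K UV W"
  assumes f: "f \<in> module_hom K T X" and g: "g \<in> module_hom K T X"
    and eq: "\<And>u v w. u \<in> carrier U \<Longrightarrow> v \<in> carrier V \<Longrightarrow> w \<in> carrier W \<Longrightarrow>
      f (pure_tensor K UV W (pure_tensor K U V u v) w) = g (pure_tensor K UV W (pure_tensor K U V u v) w)"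
    and t: "t \<in> carrier T"
  shows "f t = g t"
proof -
  interpret A: module_pair K U V using mods by (simp add: module_pair_def)
  interpret B: module_pair K UV W
    using mods A.tensor_quot(1) by (simp add: module_pair_def UV_def)
  have slice: "(\<lambda>s. pure_tensor K UV W s w) \<in> module_hom K UV T" if "w \<in> carrier W" for w
    using that by (auto simp: module_hom_def T_def B.pure_tensor_closed B.pure_tensor_bilinear)
  have "f (pure_tensor K UV W s w) = g (pure_tensor K UV W s w)"
    if "s \<in> carrier UV" and w: "w \<in> carrier W" for s w
    using A.tensor_hom_eqI[OF X, folded UV_def, OF module_hom_comp[OF slice[OF w] f]
        module_hom_comp[OF slice[OF w] g] _ that(1)] eq w by blast
  then show ?thesis
    using B.tensor_hom_eqI[OF X, folded T_def, OF f g _ t] by blast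
qed

context nonassoc_algebra
begin

lemma R12_pure_tensor:
  fixes R
  defines "AA \<equiv> tensor_module K A A"
  defines "T \<equiv> tensor_module K AA A"
  assumes R: "R \<in> module_hom K AA AA"
  shows "R12 K A R \<in> module_hom K T T"
    and "s \<in> carrier AA \<Longrightarrow> c \<in> carrier A \<Longrightarrow>
      R12 K A R (pure_tensor K AA A s c) = pure_tensor K AA A (R s) c"
proof -
  interpret P: module_pair K A A using module_axioms by (simp add: module_pair_def)
  note m = tensor_map_pure_tensor[OF P.tensor_quot(1) module_axioms P.tensor_quot(1) module_axioms
      R[unfolded AA_def] module_hom_id]
  show "R12 K A R \<in> module_hom K T T" "s \<in> carrier AA \<Longrightarrow> c \<in> carrier A \<Longrightarrow>
      R12 K A R (pure_tensor K AA A s c) = pure_tensor K AA A (R s) c"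
    unfolding R12_def Let_def T_def AA_def by (rule m; assumption)+
qed

text \<open>In general \<open>R (b \<otimes> c)\<close> is not a pure tensor, so
  \<open>tensor_assoc_inv\<close> stays in the formula; it can be evaluated once \<open>R\<close>
  has been expanded into pure tensors.\<close>

lemma R23_pure_tensor:
  fixes R
  defines "AA \<equiv> tensor_module K A A"
  defines "T \<equiv> tensor_module K AA A"
  assumes R: "R \<in> module_hom K AA AA"
  shows "R23 K A R \<in> module_hom K T T"
    and "a \<in> carrier A \<Longrightarrow> b \<in> carrier A \<Longrightarrow> c \<in> carrier A \<Longrightarrow>
      R23 K A R (pure_tensor K AA A (pure_tensor K A A a b) c)
        = tensor_assoc_inv K A A A (pure_tensor K A AA a (R (pure_tensor K A A b c)))"
proof -
  interpret P: module_pair K A A using module_axioms by (simp add: module_pair_def)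
  note as = tensor_assoc_pure_tensor[OF module_axioms module_axioms module_axioms, folded AA_def]
    and ai = tensor_assoc_inv_pure_tensor[OF module_axioms module_axioms module_axioms, folded AA_def]
    and m = tensor_map_pure_tensor[OF module_axioms P.tensor_quot(1) module_axioms P.tensor_quot(1)
      module_hom_id R[unfolded AA_def], folded AA_def]
  show "R23 K A R \<in> module_hom K T T"
    unfolding R23_def Let_def T_def AA_def[symmetric] comp_def
    by (rule module_hom_comp[OF as(1) module_hom_comp[OF m(1) ai(1)]])
  show "R23 K A R (pure_tensor K AA A (pure_tensor K A A a b) c)
        = tensor_assoc_inv K A A A (pure_tensor K A AA a (R (pure_tensor K A A b c)))"
    if "a \<in> carrier A" "b \<in> carrier A" "c \<in> carrier A"
    using that by (simp add: R23_def AA_def[symmetric] as(2) m(2) P.pure_tensor_closed[folded AA_def])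
qed

section \<open>The Yang-Baxter equation as the Leibniz identity\<close>

lemma leibniz_algebra_iff:
  "leibniz_algebra K A \<longleftrightarrow>
    (\<forall>a\<in>carrier A. \<forall>b\<in>carrier A. \<forall>c\<in>carrier A.
      (a \<otimes>\<^bsub>A\<^esub> b) \<otimes>\<^bsub>A\<^esub> c = a \<otimes>\<^bsub>A\<^esub> (b \<otimes>\<^bsub>A\<^esub> c) \<oplus>\<^bsub>A\<^esub> (a \<otimes>\<^bsub>A\<^esub> c) \<otimes>\<^bsub>A\<^esub> b)"
  using nonassoc_algebra_axioms
  by (auto simp: leibniz_algebra_def leibniz_algebra_axioms_def)

text \<open>On \<open>a \<otimes> b \<otimes> c\<close> the two sides of the Yang-Baxter equation have the same terms except for
  \<open>\<alpha>\<beta>\<^sup>2 z \<otimes> z \<otimes> (ab)c\<close> on the left and \<open>\<alpha>\<beta>\<^sup>2 z \<otimes> z \<otimes> (a(bc) + (ac)b)\<close> on the right.\<close>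

lemma qybe_solution_iff_leibniz:
  assumes \<alpha>: "\<alpha> \<in> carrier K" "\<alpha> \<noteq> \<zero>\<^bsub>K\<^esub>" and \<beta>: "\<beta> \<in> carrier K" "\<beta> \<noteq> \<zero>\<^bsub>K\<^esub>"
    and z: "z \<in> leibniz_center A" "z \<noteq> \<zero>\<^bsub>A\<^esub>"
  shows "qybe_solution K A (R_map K A \<alpha> \<beta> z) \<longleftrightarrow> leibniz_algebra K A"
proof -
  define AA T where "AA = tensor_module K A A" and "T = tensor_module K AA A"
  define R where "R = R_map K A \<alpha> \<beta> z"
  define p where "p a b c = pure_tensor K AA A (pure_tensor K A A a b) c" for a b c
  have z0: "z \<otimes>\<^bsub>A\<^esub> a = \<zero>\<^bsub>A\<^esub>" "a \<otimes>\<^bsub>A\<^esub> z = \<zero>\<^bsub>A\<^esub>" if "a \<in> carrier A" for a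
    using z(1) that by (auto simp: leibniz_center_def)
  have zc: "z \<in> carrier A" using z(1) by (simp add: leibniz_center_def)
  interpret P: module_pair K A A using module_axioms by (simp add: module_pair_def)
  interpret AA: module K AA unfolding AA_def by (rule P.tensor_quot(1))
  interpret Q: module_pair K AA A using module_axioms AA.module_axioms by (simp add: module_pair_def)
  interpret Q': module_pair K A AA using module_axioms AA.module_axioms by (simp add: module_pair_def)
  interpret T: module K T unfolding T_def by (rule Q.tensor_quot(1))
  interpret T': module K "tensor_module K A AA" by (rule Q'.tensor_quot(1))
  note pc = P.pure_tensor_closed[folded AA_def] and pb = P.pure_tensor_bilinear[folded AA_def]
    and pz = P.pure_tensor_zero[folded AA_def]
  have p_closed: "p a b c \<in> carrier T" if "a \<in> carrier A" "b \<in> carrier A" "c \<in> carrier A" for a b c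
    using that by (simp add: p_def T_def Q.pure_tensor_closed pc)
  \<comment> \<open>\<open>R12\<close> creates products in the second slot and \<open>R23\<close> in
    the third, so these are the slots where a product with \<open>z\<close> produces a zero.\<close>
  have p_zero: "p a \<zero>\<^bsub>A\<^esub> c = \<zero>\<^bsub>T\<^esub>" "p a c \<zero>\<^bsub>A\<^esub> = \<zero>\<^bsub>T\<^esub>" if "a \<in> carrier A" "c \<in> carrier A" for a c
    using that by (simp_all add: p_def T_def pz pc Q.pure_tensor_zero)
  have p_add: "p a b (c \<oplus>\<^bsub>A\<^esub> d) = p a b c \<oplus>\<^bsub>T\<^esub> p a b d"
    if "a \<in> carrier A" "b \<in> carrier A" "c \<in> carrier A" "d \<in> carrier A" for a b c d
    using that by (simp add: p_def T_def pc Q.pure_tensor_bilinear)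
  note R = R_map_pure_tensor[OF \<alpha>(1) \<beta>(1) zc, folded AA_def R_def]
  note R12 = R12_pure_tensor[of R, folded AA_def, folded T_def, OF R(1)]
  note R23 = R23_pure_tensor[of R, folded AA_def, folded T_def, OF R(1)]
  note ai = tensor_assoc_inv_pure_tensor[OF module_axioms module_axioms module_axioms,
      folded AA_def, folded T_def]
  have R12p: "R12 K A R (p a b c) = \<alpha> \<odot>\<^bsub>T\<^esub> p b a c \<oplus>\<^bsub>T\<^esub> \<beta> \<odot>\<^bsub>T\<^esub> p z (a \<otimes>\<^bsub>A\<^esub> b) c"
    if "a \<in> carrier A" "b \<in> carrier A" "c \<in> carrier A" for a b c
    using that \<alpha> \<beta> zc
    by (simp add: p_def R12 R pc mult_closed Q.pure_tensor_bilinear T_def)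
  have R23p: "R23 K A R (p a b c) = \<alpha> \<odot>\<^bsub>T\<^esub> p a c b \<oplus>\<^bsub>T\<^esub> \<beta> \<odot>\<^bsub>T\<^esub> p a z (b \<otimes>\<^bsub>A\<^esub> c)"
    if "a \<in> carrier A" "b \<in> carrier A" "c \<in> carrier A" for a b c
    using that \<alpha> \<beta> zc
    by (simp add: p_def R23 R pc mult_closed Q'.pure_tensor_bilinear Q'.pure_tensor_closed
        module_hom_add[OF ai(1)] module_hom_smult[OF ai(1)] ai(2))
  note simps = R12p R23p module_hom_add[OF R12(1)] module_hom_smult[OF R12(1)]
    module_hom_add[OF R23(1)] module_hom_smult[OF R23(1)] p_closed mult_closed zc z0 p_zero p_add
    \<alpha>(1) \<beta>(1)
  \<comment> \<open>The terms common to both sides: the reversal of the three factors, and the three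
    terms containing exactly one product.\<close>
  let ?S = "\<lambda>a b c. (\<alpha> \<otimes>\<^bsub>K\<^esub> (\<alpha> \<otimes>\<^bsub>K\<^esub> \<alpha>)) \<odot>\<^bsub>T\<^esub> p c b a
    \<oplus>\<^bsub>T\<^esub> ((\<alpha> \<otimes>\<^bsub>K\<^esub> (\<alpha> \<otimes>\<^bsub>K\<^esub> \<beta>)) \<odot>\<^bsub>T\<^esub> p z (b \<otimes>\<^bsub>A\<^esub> c) a
    \<oplus>\<^bsub>T\<^esub> ((\<alpha> \<otimes>\<^bsub>K\<^esub> (\<alpha> \<otimes>\<^bsub>K\<^esub> \<beta>)) \<odot>\<^bsub>T\<^esub> p z b (a \<otimes>\<^bsub>A\<^esub> c)
    \<oplus>\<^bsub>T\<^esub> (\<alpha> \<otimes>\<^bsub>K\<^esub> (\<alpha> \<otimes>\<^bsub>K\<^esub> \<beta>)) \<odot>\<^bsub>T\<^esub> p c z (a \<otimes>\<^bsub>A\<^esub> b)))"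
  let ?k = "\<alpha> \<otimes>\<^bsub>K\<^esub> (\<beta> \<otimes>\<^bsub>K\<^esub> \<beta>)"
  have lhs: "R12 K A R (R23 K A R (R12 K A R (p a b c)))
      = ?k \<odot>\<^bsub>T\<^esub> p z z ((a \<otimes>\<^bsub>A\<^esub> b) \<otimes>\<^bsub>A\<^esub> c) \<oplus>\<^bsub>T\<^esub> ?S a b c"
    if "a \<in> carrier A" "b \<in> carrier A" "c \<in> carrier A" for a b c
  proof -
    have 1: "R23 K A R (R12 K A R (p a b c)) = \<alpha> \<odot>\<^bsub>T\<^esub> (\<alpha> \<odot>\<^bsub>T\<^esub> p b c a \<oplus>\<^bsub>T\<^esub> \<beta> \<odot>\<^bsub>T\<^esub> p b z (a \<otimes>\<^bsub>A\<^esub> c))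
        \<oplus>\<^bsub>T\<^esub> \<beta> \<odot>\<^bsub>T\<^esub> (\<alpha> \<odot>\<^bsub>T\<^esub> p z c (a \<otimes>\<^bsub>A\<^esub> b) \<oplus>\<^bsub>T\<^esub> \<beta> \<odot>\<^bsub>T\<^esub> p z z ((a \<otimes>\<^bsub>A\<^esub> b) \<otimes>\<^bsub>A\<^esub> c))"
      using that by (simp add: simps)
    \<comment> \<open>Of the eight summands, three contain \<open>bz\<close>, \<open>zc\<close> or
      \<open>zz\<close> and have vanished.\<close>
    have 2: "R12 K A R (R23 K A R (R12 K A R (p a b c))) =
        \<alpha> \<odot>\<^bsub>T\<^esub> (\<alpha> \<odot>\<^bsub>T\<^esub> (\<alpha> \<odot>\<^bsub>T\<^esub> p c b a \<oplus>\<^bsub>T\<^esub> \<beta> \<odot>\<^bsub>T\<^esub> p z (b \<otimes>\<^bsub>A\<^esub> c) a) \<oplus>\<^bsub>T\<^esub> \<beta> \<odot>\<^bsub>T\<^esub> (\<alpha> \<odot>\<^bsub>T\<^esub> p z b (a \<otimes>\<^bsub>A\<^esub> c)))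
        \<oplus>\<^bsub>T\<^esub> \<beta> \<odot>\<^bsub>T\<^esub> (\<alpha> \<odot>\<^bsub>T\<^esub> (\<alpha> \<odot>\<^bsub>T\<^esub> p c z (a \<otimes>\<^bsub>A\<^esub> b)) \<oplus>\<^bsub>T\<^esub> \<beta> \<odot>\<^bsub>T\<^esub> (\<alpha> \<odot>\<^bsub>T\<^esub> p z z ((a \<otimes>\<^bsub>A\<^esub> b) \<otimes>\<^bsub>A\<^esub> c)))"
      unfolding 1 using that by (simp add: simps)
    show ?thesis unfolding 2
      using that by (simp add: p_closed mult_closed zc \<alpha>(1) \<beta>(1) T.smult_r_distr T.smult_assoc1[symmetric] R.m_ac T.M.a_ac)
  qed
  have rhs: "R23 K A R (R12 K A R (R23 K A R (p a b c)))
      = ?k \<odot>\<^bsub>T\<^esub> p z z (a \<otimes>\<^bsub>A\<^esub> (b \<otimes>\<^bsub>A\<^esub> c) \<oplus>\<^bsub>A\<^esub> (a \<otimes>\<^bsub>A\<^esub> c) \<otimes>\<^bsub>A\<^esub> b) \<oplus>\<^bsub>T\<^esub> ?S a b c"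
    if "a \<in> carrier A" "b \<in> carrier A" "c \<in> carrier A" for a b c
  proof -
    \<comment> \<open>The only vanishing term of this side is lost here: \<open>R12\<close> applied
      to \<open>a \<otimes> z \<otimes> bc\<close> would contribute the product \<open>az\<close>.
      Two terms beginning with \<open>z \<otimes> z\<close> survive at the end, and
      \<open>p_add\<close> matches them with a single one.\<close>
    have 1: "R12 K A R (R23 K A R (p a b c)) = \<alpha> \<odot>\<^bsub>T\<^esub> (\<alpha> \<odot>\<^bsub>T\<^esub> p c a b \<oplus>\<^bsub>T\<^esub> \<beta> \<odot>\<^bsub>T\<^esub> p z (a \<otimes>\<^bsub>A\<^esub> c) b)
        \<oplus>\<^bsub>T\<^esub> \<beta> \<odot>\<^bsub>T\<^esub> (\<alpha> \<odot>\<^bsub>T\<^esub> p z a (b \<otimes>\<^bsub>A\<^esub> c))"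
      using that by (simp add: simps)
    have 2: "R23 K A R (R12 K A R (R23 K A R (p a b c))) =
        \<alpha> \<odot>\<^bsub>T\<^esub> (\<alpha> \<odot>\<^bsub>T\<^esub> (\<alpha> \<odot>\<^bsub>T\<^esub> p c b a \<oplus>\<^bsub>T\<^esub> \<beta> \<odot>\<^bsub>T\<^esub> p c z (a \<otimes>\<^bsub>A\<^esub> b))
          \<oplus>\<^bsub>T\<^esub> \<beta> \<odot>\<^bsub>T\<^esub> (\<alpha> \<odot>\<^bsub>T\<^esub> p z b (a \<otimes>\<^bsub>A\<^esub> c) \<oplus>\<^bsub>T\<^esub> \<beta> \<odot>\<^bsub>T\<^esub> p z z ((a \<otimes>\<^bsub>A\<^esub> c) \<otimes>\<^bsub>A\<^esub> b)))
        \<oplus>\<^bsub>T\<^esub> \<beta> \<odot>\<^bsub>T\<^esub> (\<alpha> \<odot>\<^bsub>T\<^esub> (\<alpha> \<odot>\<^bsub>T\<^esub> p z (b \<otimes>\<^bsub>A\<^esub> c) a \<oplus>\<^bsub>T\<^esub> \<beta> \<odot>\<^bsub>T\<^esub> p z z (a \<otimes>\<^bsub>A\<^esub> (b \<otimes>\<^bsub>A\<^esub> c))))"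
      unfolding 1 using that by (simp add: simps)
    show ?thesis unfolding 2
      using that by (simp add: p_closed p_add mult_closed zc \<alpha>(1) \<beta>(1) T.smult_r_distr T.smult_assoc1[symmetric] R.m_ac T.M.a_ac)
  qed
  have k: "?k \<in> carrier K" "?k \<noteq> \<zero>\<^bsub>K\<^esub>" using \<alpha> \<beta> by (simp_all add: integral_iff)
  \<comment> \<open>The scalar is absorbed into the left factor:
    \<open>k (z \<otimes> z) = z \<otimes> kz\<close> is nonzero by
    \<open>pure_tensor_eq_zeroD\<close>, and a second use of that lemma shows that tensoring with
    this fixed nonzero element has trivial kernel.\<close>
  have inj: "x = y" if xy: "x \<in> carrier A" "y \<in> carrier A"
    and eq: "?k \<odot>\<^bsub>T\<^esub> p z z x = ?k \<odot>\<^bsub>T\<^esub> p z z y" for x y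
  proof -
    have zz: "pure_tensor K A A z z \<noteq> \<zero>\<^bsub>AA\<^esub>" "pure_tensor K A A z z \<in> carrier AA"
      using P.pure_tensor_eq_zeroD[OF field_axioms zc z(2) zc] z(2) pc zc unfolding AA_def by auto
    have kz: "?k \<odot>\<^bsub>AA\<^esub> pure_tensor K A A z z \<noteq> \<zero>\<^bsub>AA\<^esub>"
    proof
      assume "?k \<odot>\<^bsub>AA\<^esub> pure_tensor K A A z z = \<zero>\<^bsub>AA\<^esub>"
      then have "pure_tensor K A A z (?k \<odot>\<^bsub>A\<^esub> z) = \<zero>\<^bsub>AA\<^esub>" using pb(4) k zc by simp
      then have "?k \<odot>\<^bsub>A\<^esub> z = \<zero>\<^bsub>A\<^esub>"
        using P.pure_tensor_eq_zeroD[OF field_axioms zc z(2), folded AA_def] k zc by simp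
      then have "inv\<^bsub>K\<^esub> ?k \<odot>\<^bsub>A\<^esub> (?k \<odot>\<^bsub>A\<^esub> z) = \<zero>\<^bsub>A\<^esub>" using k by (simp add: field_Units)
      then show False using k zc z(2) by (simp add: smult_assoc1[symmetric] field_Units del: R.m_assoc)
    qed
    have e: "x \<ominus>\<^bsub>A\<^esub> y \<in> carrier A" using xy by simp
    let ?f = "\<lambda>x. pure_tensor K AA A (?k \<odot>\<^bsub>AA\<^esub> pure_tensor K A A z z) x"
    have f: "?f \<in> module_hom K A T"
      using zz(2) k by (auto simp: module_hom_def T_def Q.pure_tensor_closed Q.pure_tensor_bilinear(2,4))
    have fe: "?f x = ?k \<odot>\<^bsub>T\<^esub> p z z x" if "x \<in> carrier A" for x
      using that zz(2) k by (simp add: T_def p_def Q.pure_tensor_bilinear)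
    have "?f (x \<ominus>\<^bsub>A\<^esub> y) = ?f x \<ominus>\<^bsub>T\<^esub> ?f y" by (rule hom_minus(1)[OF T.module_axioms f xy])
    also have "\<dots> = \<zero>\<^bsub>T\<^esub>"
      using xy eq k zc by (simp add: fe T.M.minus_zero_iff p_closed)
    finally have "x \<ominus>\<^bsub>A\<^esub> y = \<zero>\<^bsub>A\<^esub>"
      using Q.pure_tensor_eq_zeroD[OF field_axioms _ kz e] zz k unfolding T_def by blast
    then show ?thesis using xy by (simp add: M.minus_zero_iff)
  qed
  have pure: "R12 K A R (R23 K A R (R12 K A R (p a b c))) = R23 K A R (R12 K A R (R23 K A R (p a b c)))
    \<longleftrightarrow> (a \<otimes>\<^bsub>A\<^esub> b) \<otimes>\<^bsub>A\<^esub> c = a \<otimes>\<^bsub>A\<^esub> (b \<otimes>\<^bsub>A\<^esub> c) \<oplus>\<^bsub>A\<^esub> (a \<otimes>\<^bsub>A\<^esub> c) \<otimes>\<^bsub>A\<^esub> b"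
    if "a \<in> carrier A" "b \<in> carrier A" "c \<in> carrier A" for a b c
  proof -
    have S: "?S a b c \<in> carrier T" using that zc \<alpha> \<beta> by (simp add: p_closed mult_closed)
    have y: "?k \<odot>\<^bsub>T\<^esub> p z z x \<in> carrier T" if "x \<in> carrier A" for x using that zc k by (simp add: p_closed)
    show ?thesis
      unfolding lhs[OF that] rhs[OF that]
      by (subst T.M.add.right_cancel[OF S y y]) (use that in \<open>auto simp: mult_closed intro: inj\<close>)
  qed
  note RT = R12(1) R23(1)
  have "qybe_solution K A R \<longleftrightarrow>
    (\<forall>t\<in>carrier T. R12 K A R (R23 K A R (R12 K A R t)) = R23 K A R (R12 K A R (R23 K A R t)))"
    unfolding qybe_solution_def using R(1) by (simp add: AA_def T_def)
  also have "\<dots> \<longleftrightarrow> (\<forall>a\<in>carrier A. \<forall>b\<in>carrier A. \<forall>c\<in>carrier A.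
    R12 K A R (R23 K A R (R12 K A R (p a b c))) = R23 K A R (R12 K A R (R23 K A R (p a b c))))"
  proof (intro iffI ballI, goal_cases)
    case (1 a b c)
    then show ?case using p_closed by blast
  next
    case (2 t)
    show ?case
      by (rule tensor_triple_hom_eqI[OF module_axioms module_axioms module_axioms T.module_axioms,
          folded AA_def, folded T_def,
          OF module_hom_comp[OF module_hom_comp[OF RT(1) RT(2)] RT(1)]
            module_hom_comp[OF module_hom_comp[OF RT(2) RT(1)] RT(2)]])
        (use 2 in \<open>auto simp: p_def\<close>)
  qed
  also have "\<dots> \<longleftrightarrow> leibniz_algebra K A" unfolding leibniz_algebra_iff using pure by simp
  finally show ?thesis unfolding R_def .
qed

end

section \<open>Jacobi-Jordan algebras: characteristic 2 and nilpotency\<close>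

text \<open>The additive order of 1 divides \<open>n\<close> exactly when \<open>n\<close> times 1
  is zero. It is not 1, since 1 is not 0 in a field, and the value 0 for infinite order does not
  divide 2; so dividing 2 means being 2.\<close>

lemma (in field) ring_char_eq_2_iff: "ring_char R = 2 \<longleftrightarrow> \<one> \<oplus> \<one> = \<zero>"
proof -
  have g: "ring_char R dvd n \<longleftrightarrow> add_pow R n \<one> = \<zero>" for n :: nat
    using add.pow_eq_id[OF one_closed, of n] by (simp add: ring_char_def add_pow_def)
  have "ring_char R \<noteq> 1" using g[of 1] by (auto simp: add.nat_pow_Suc)
  then have "ring_char R = 2 \<longleftrightarrow> ring_char R dvd 2"
    using dvd_imp_le[of "ring_char R" 2] by (cases "ring_char R") (auto simp: numeral_2_eq_2)
  also have "\<dots> \<longleftrightarrow> \<one> \<oplus> \<one> = \<zero>" unfolding g by (simp add: numeral_2_eq_2)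
  finally show ?thesis .
qed

context module
begin

lemma span_eq_zero_iff:
  assumes "S \<subseteq> carrier M"
  shows "span S = {\<zero>\<^bsub>M\<^esub>} \<longleftrightarrow> S \<subseteq> {\<zero>\<^bsub>M\<^esub>}"
proof
  assume "span S = {\<zero>\<^bsub>M\<^esub>}"
  then show "S \<subseteq> {\<zero>\<^bsub>M\<^esub>}" using in_own_span[OF assms] by simp
next
  assume S: "S \<subseteq> {\<zero>\<^bsub>M\<^esub>}"
  have "LinearCombinations.submodule R {\<zero>\<^bsub>M\<^esub>} M"
    using module_axioms by (auto simp: LinearCombinations.submodule_def)
  then have "span S \<subseteq> {\<zero>\<^bsub>M\<^esub>}" by (rule span_is_subset[OF S])
  moreover have "\<zero>\<^bsub>M\<^esub> \<in> span S"
    using span_is_submodule[OF assms] by (simp add: LinearCombinations.submodule_def)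
  ultimately show "span S = {\<zero>\<^bsub>M\<^esub>}" by blast
qed

end

context jacobi_jordan_algebra
begin

text \<open>The third term of the series is spanned by \<open>A A\<^sup>2\<close> and
  \<open>A\<^sup>2 A\<close>, which commutativity makes equivalent conditions. Since
  \<open>A\<^sup>2\<close> is spanned by products, its annihilation by \<open>A\<close> can be
  tested on the elements \<open>bc\<close>.\<close>

lemma at_most_3_step_nilpotent_iff:
  "at_most_step_nilpotent K A 3 \<longleftrightarrow>
    (\<forall>a\<in>carrier A. \<forall>b\<in>carrier A. \<forall>c\<in>carrier A. a \<otimes>\<^bsub>A\<^esub> (b \<otimes>\<^bsub>A\<^esub> c) = \<zero>\<^bsub>A\<^esub>)"
proof -
  let ?A2 = "lower_central K A 2"
  have ss: "X \<subseteq> carrier A \<Longrightarrow> span X \<subseteq> carrier A" for X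
    using span_is_submodule[of X] by (simp add: LinearCombinations.submodule_def)
  have sp: "subspace_prod K A X Y \<subseteq> carrier A" if "X \<subseteq> carrier A" "Y \<subseteq> carrier A" for X Y
    unfolding subspace_prod_def using that mult_closed by (intro ss) blast
  have L1: "lower_central K A (Suc 0) = carrier A" by (simp add: lower_central.simps)
  have L2: "?A2 = span (subspace_prod K A (carrier A) (carrier A))"
    by (subst lower_central.simps) (simp add: L1)
  have L3: "lower_central K A 3 =
      span (subspace_prod K A (carrier A) ?A2 \<union> subspace_prod K A ?A2 (carrier A))"
  proof -
    \<comment> \<open>The index 1 gives \<open>A A\<^sup>2\<close> and the index 2 gives
      \<open>A\<^sup>2 A\<close>.\<close>
    have "{1..3 - 1} = {1, 2::nat}" by auto
    then show ?thesis by (subst lower_central.simps) (simp add: L1)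
  qed
  have A2: "?A2 \<subseteq> carrier A" unfolding L2 by (intro ss sp) auto
  have "at_most_step_nilpotent K A 3 \<longleftrightarrow>
      subspace_prod K A (carrier A) ?A2 \<union> subspace_prod K A ?A2 (carrier A) \<subseteq> {\<zero>\<^bsub>A\<^esub>}"
    unfolding at_most_step_nilpotent_def L3 by (rule span_eq_zero_iff) (use sp A2 in simp)
  also have "\<dots> \<longleftrightarrow> (\<forall>a\<in>carrier A. \<forall>x\<in>?A2. a \<otimes>\<^bsub>A\<^esub> x = \<zero>\<^bsub>A\<^esub>)"
  proof -
    have s: "subspace_prod K A X Y \<subseteq> {\<zero>\<^bsub>A\<^esub>} \<longleftrightarrow> (\<forall>x\<in>X. \<forall>y\<in>Y. x \<otimes>\<^bsub>A\<^esub> y = \<zero>\<^bsub>A\<^esub>)"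
      if "X \<subseteq> carrier A" "Y \<subseteq> carrier A" for X Y
    proof -
      have c: "{x \<otimes>\<^bsub>A\<^esub> y |x y. x \<in> X \<and> y \<in> Y} \<subseteq> carrier A" using that mult_closed by blast
      have "\<zero>\<^bsub>A\<^esub> \<in> subspace_prod K A X Y"
        unfolding subspace_prod_def using span_is_submodule[OF c]
        by (simp add: LinearCombinations.submodule_def)
      then show ?thesis using span_eq_zero_iff[OF c] unfolding subspace_prod_def by blast
    qed
    have "x \<otimes>\<^bsub>A\<^esub> a = a \<otimes>\<^bsub>A\<^esub> x" if "x \<in> ?A2" "a \<in> carrier A" for x a
      using that A2 by (intro mult_commute) auto
    then show ?thesis unfolding Un_subset_iff s[OF subset_refl A2] s[OF A2 subset_refl] by auto
  qed
  also have "\<dots> \<longleftrightarrow> (\<forall>a\<in>carrier A. \<forall>b\<in>carrier A. \<forall>c\<in>carrier A. a \<otimes>\<^bsub>A\<^esub> (b \<otimes>\<^bsub>A\<^esub> c) = \<zero>\<^bsub>A\<^esub>)"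
    (is "?l \<longleftrightarrow> ?r")
  proof
    have c: "{x \<otimes>\<^bsub>A\<^esub> y |x y. x \<in> carrier A \<and> y \<in> carrier A} \<subseteq> carrier A" using mult_closed by blast
    have in2: "b \<otimes>\<^bsub>A\<^esub> c \<in> ?A2" if "b \<in> carrier A" "c \<in> carrier A" for b c
      using that in_own_span[OF c] in_own_span[OF sp[of "carrier A" "carrier A"]]
      unfolding L2 subspace_prod_def by blast
    then show "?l \<Longrightarrow> ?r" by blast
    assume r: ?r
    show ?l
    proof
      fix a assume a: "a \<in> carrier A"
      \<comment> \<open>The elements killed by left multiplication with \<open>a\<close> form a
        subspace. It contains all products, hence their span, hence the outer span in the definition
        of \<open>lower_central\<close>.\<close>
      let ?N = "{x \<in> carrier A. a \<otimes>\<^bsub>A\<^esub> x = \<zero>\<^bsub>A\<^esub>}"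
      have "a \<otimes>\<^bsub>A\<^esub> \<zero>\<^bsub>A\<^esub> = \<zero>\<^bsub>A\<^esub>"
        using mult_smult_right[of "\<zero>\<^bsub>K\<^esub>" a "\<zero>\<^bsub>A\<^esub>"] a mult_closed by simp
      then have N: "LinearCombinations.submodule K ?N A"
        using a by (intro LinearCombinations.submodule.intro module_axioms)
          (auto simp: mult_add_right mult_smult_right)
      have "subspace_prod K A (carrier A) (carrier A) \<subseteq> ?N"
        unfolding subspace_prod_def
        by (rule span_is_subset[OF _ N]) (use r a mult_closed in auto)
      then have "?A2 \<subseteq> ?N" unfolding L2 by (rule span_is_subset[OF _ N])
      then show "\<forall>x\<in>?A2. a \<otimes>\<^bsub>A\<^esub> x = \<zero>\<^bsub>A\<^esub>" by blast
    qed
  qed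
  finally show ?thesis .
qed

text \<open>By commutativity the Leibniz identity reads \<open>c(ab) = a(bc) + b(ca)\<close>; subtracted from the
  Jacobi identity it leaves \<open>2 c(ab) = 0\<close>.\<close>

lemma leibniz_iff_char_2_or_nilpotent:
  "leibniz_algebra K A \<longleftrightarrow> ring_char K = 2 \<or> at_most_step_nilpotent K A 3"
proof -
  \<comment> \<open>Outside characteristic 2 the scalar \<open>1 + 1\<close> is invertible.\<close>
  have dbl: "x \<oplus>\<^bsub>A\<^esub> x = \<zero>\<^bsub>A\<^esub> \<longleftrightarrow> ring_char K = 2 \<or> x = \<zero>\<^bsub>A\<^esub>" if x: "x \<in> carrier A" for x
  proof -
    let ?t = "\<one>\<^bsub>K\<^esub> \<oplus>\<^bsub>K\<^esub> \<one>\<^bsub>K\<^esub>"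
    have t: "?t \<odot>\<^bsub>A\<^esub> x = x \<oplus>\<^bsub>A\<^esub> x" using x by (simp add: smult_l_distr)
    have "x = \<zero>\<^bsub>A\<^esub>" if "?t \<noteq> \<zero>\<^bsub>K\<^esub>" "x \<oplus>\<^bsub>A\<^esub> x = \<zero>\<^bsub>A\<^esub>"
    proof -
      have "x = (inv\<^bsub>K\<^esub> ?t \<otimes>\<^bsub>K\<^esub> ?t) \<odot>\<^bsub>A\<^esub> x" using that x by (simp add: field_Units)
      also have "\<dots> = inv\<^bsub>K\<^esub> ?t \<odot>\<^bsub>A\<^esub> (?t \<odot>\<^bsub>A\<^esub> x)"
        using that x by (intro smult_assoc1) (auto simp: field_Units)
      also have "\<dots> = \<zero>\<^bsub>A\<^esub>" unfolding t using that by (simp add: field_Units)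
      finally show ?thesis .
    qed
    then show ?thesis using t x by (auto simp: ring_char_eq_2_iff)
  qed
  have key: "(a \<otimes>\<^bsub>A\<^esub> b) \<otimes>\<^bsub>A\<^esub> c = a \<otimes>\<^bsub>A\<^esub> (b \<otimes>\<^bsub>A\<^esub> c) \<oplus>\<^bsub>A\<^esub> (a \<otimes>\<^bsub>A\<^esub> c) \<otimes>\<^bsub>A\<^esub> b \<longleftrightarrow>
      ring_char K = 2 \<or> c \<otimes>\<^bsub>A\<^esub> (a \<otimes>\<^bsub>A\<^esub> b) = \<zero>\<^bsub>A\<^esub>"
    if abc: "a \<in> carrier A" "b \<in> carrier A" "c \<in> carrier A" for a b c
  proof -
    let ?x = "c \<otimes>\<^bsub>A\<^esub> (a \<otimes>\<^bsub>A\<^esub> b)" and ?y = "a \<otimes>\<^bsub>A\<^esub> (b \<otimes>\<^bsub>A\<^esub> c) \<oplus>\<^bsub>A\<^esub> b \<otimes>\<^bsub>A\<^esub> (c \<otimes>\<^bsub>A\<^esub> a)"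
    have x: "?x \<in> carrier A" and y: "?y \<in> carrier A" using abc by (auto simp: mult_closed)
    have "(a \<otimes>\<^bsub>A\<^esub> b) \<otimes>\<^bsub>A\<^esub> c = ?x" "(a \<otimes>\<^bsub>A\<^esub> c) \<otimes>\<^bsub>A\<^esub> b = b \<otimes>\<^bsub>A\<^esub> (c \<otimes>\<^bsub>A\<^esub> a)"
      using abc mult_commute[of "a \<otimes>\<^bsub>A\<^esub> b" c] mult_commute[of "a \<otimes>\<^bsub>A\<^esub> c" b] mult_commute[of a c]
      by (simp_all add: mult_closed)
    \<comment> \<open>The Jacobi identity says \<open>?y + ?x = 0\<close>, so
      \<open>?x + ?x = 0\<close> becomes \<open>?x + ?x = ?y + ?x\<close>, and \<open>?x\<close>
      cancels.\<close>
    moreover have "?x \<oplus>\<^bsub>A\<^esub> ?x = \<zero>\<^bsub>A\<^esub> \<longleftrightarrow> ?x = ?y"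
      using M.add.right_cancel[OF x x y] unfolding jacobi[OF abc] .
    ultimately show ?thesis using dbl[OF x] by simp
  qed
  \<comment> \<open>The condition on the characteristic does not depend on \<open>a\<close>,
    \<open>b\<close>, \<open>c\<close>, so the disjunction moves out of the quantifiers; renaming
    the variables turns \<open>c(ab)\<close> into \<open>a(bc)\<close>.\<close>
  show ?thesis
    unfolding leibniz_algebra_iff at_most_3_step_nilpotent_iff using key by auto
qed

end

theorem proposition1p2:
  fixes K :: "('k, 'm) ring_scheme" and A :: "('k, 'a, 'n) module_scheme"
    and \<alpha> \<beta> :: 'k and z :: 'a
  assumes "nonassoc_algebra K A"
    and "\<alpha> \<in> carrier K - {\<zero>\<^bsub>K\<^esub>}" and "\<beta> \<in> carrier K - {\<zero>\<^bsub>K\<^esub>}"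
    and "z \<in> leibniz_center A" and "z \<noteq> \<zero>\<^bsub>A\<^esub>"
  shows "(qybe_solution K A (R_map K A \<alpha> \<beta> z) \<longleftrightarrow> leibniz_algebra K A) \<and>
    (jacobi_jordan_algebra K A \<longrightarrow>
      (qybe_solution K A (R_map K A \<alpha> \<beta> z) \<longleftrightarrow>
        ring_char K = 2 \<or> at_most_step_nilpotent K A 3))"
proof -
  have "qybe_solution K A (R_map K A \<alpha> \<beta> z) \<longleftrightarrow> leibniz_algebra K A"
    using assms by (intro nonassoc_algebra.qybe_solution_iff_leibniz) auto
  then show ?thesis
    using jacobi_jordan_algebra.leibniz_iff_char_2_or_nilpotent by blast
qed

end
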